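(* Fix an integer $h\ge1$. As formal multivariate Dirichlet series, $$\mathcal E^e_{\mathcal D}(s_1,\dots,s_h;h)=\mathcal Z(s_1,\dots,s_h)^2,\qquad \mathcal E^p_{\mathcal D}(s_1,\dots,s_h;h)=\mathcal Z^\blacktriangle(s_1,\dots,s_h)^2,$$ and, as formal power series, $$\mathcal E^e(x_1,\dots,x_h;h)=\sum_{n_1\ge\dots\ge n_h\ge1}\frac{x_1^{n_1}\cdots x_h^{n_h}}{(1-x_1^{n_1})(1-x_1^{n_1}x_2^{n_2})\cdots(1-x_1^{n_1}\cdots x_h^{n_h})},$$ $$\mathcal E^p(x_1,\dots,x_h;h)=\sum_{n_1\ge\dots\ge n_h\ge1}\frac{(n_1-n_2+1)\cdots(n_{h-1}-n_h+1)\,x_1^{n_1}\cdots x_h^{n_h}}{(1-x_1^{n_1})^2(1-x_1^{n_1}x_2^{n_2})^2\cdots(1-x_1^{n_1}\cdots x_{h-1}^{n_{h-1}})^2(1-x_1^{n_1}\cdots x_h^{n_h})}.$$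
   Context: An espalier of height $h$ is a set of unit cells of $\mathbb Z^3$ of the form $\bigcup_{a=0}^{h-1}\{a\}\times\{0,\dots,p_a-1\}\times\{0,\dots,q_a-1\}$ with integers $p_0\ge\dots\ge p_{h-1}\ge1$, $q_0\ge\dots\ge q_{h-1}\ge1$. A pyramid of height $h$ is a set of cells of the form $\bigcup_{a=0}^{h-1}\{a\}\times R_a$, where $R_a=\{b_a,\dots,b_a+p_a-1\}\times\{c_a,\dots,c_a+q_a-1\}$ with $p_a,q_a\ge1$, $b_0=c_0=0$ and $R_a\subseteq R_{a-1}$ for $a\ge1$ (so espaliers are the pyramids with all $b_a=c_a=0$). The $(a+1)$-th plateau $\{a\}\times R_a$ has volume $p_aq_a$. For $t\in\{e,p\}$, $n^t_{[m_1,\dots,m_h]}$ is the number of espaliers ($t=e$) resp. pyramids ($t=p$) of height $h$ whose $i$-th plateau has volume $m_i$, $i=1,\dots,h$ (nonzero only if $m_1\ge\dots\ge m_h\ge1$). Define $\mathcal E^t(x_1,\dots,x_h;h)=\sum_{m_1\ge\dots\ge m_h\ge1}n^t_{[m_1,\dots,m_h]}x_1^{m_1}\cdots x_h^{m_h}$ and $\mathcal E^t_{\mathcal D}(s_1,\dots,s_h;h)=\sum_{m_1\ge\dots\ge m_h\ge1}\frac{n^t_{[m_1,\dots,m_h]}}{m_1^{s_1}\cdots m_h^{s_h}}$. Also $\mathcal Z(s_1,\dots,s_h)=\sum_{n_1\ge\dots\ge n_h\ge1}\frac{1}{n_1^{s_1}\cdots n_h^{s_h}}$ and $\mathcal Z^\blacktriangle(s_1,\dots,s_h)=\sum_{n_1\ge\dots\ge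 n_h\ge1}\frac{(n_1-n_2+1)\cdots(n_{h-1}-n_h+1)}{n_1^{s_1}\cdots n_h^{s_h}}$, formal Dirichlet series multiplied via $n^{-s}m^{-s}=(nm)^{-s}$ in each variable. *)

theory Defs
  imports Main "HOL-Library.Poly_Mapping"
begin

section \<open>Convolution over a commutative monoid with finitely many factorisations\<close>

locale finite_factorisation = comm_monoid f z
  for f :: "'m \<Rightarrow> 'm \<Rightarrow> 'm" and z :: 'm +
  assumes finite_factors: "finite {(k, l). f k l = m}"
begin

lemma conv_commute:
  fixes F G :: "'m \<Rightarrow> 'a::comm_ring_1"
  shows "(\<Sum>(k, l) | f k l = m. F k * G l) = (\<Sum>(k, l) | f k l = m. G k * F l)"
  by (rule sum.reindex_bij_witness[where i = prod.swap and j = prod.swap])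
     (auto simp: commute mult.commute)

lemma conv_one:
  fixes F :: "'m \<Rightarrow> 'a::comm_ring_1"
  shows "(\<Sum>(k, l) | f k l = m. (if k = z then 1 else 0) * F l) = F m"
proof -
  have "(\<Sum>(k, l) | f k l = m. (if k = z then 1 else 0) * F l)
      = (\<Sum>(k, l) \<in> {(z, m)}. (if k = z then 1 else 0) * F l)"
    by (rule sum.mono_neutral_right) (use finite_factors[of m] in \<open>auto split: if_splits\<close>)
  then show ?thesis by simp
qed

lemma conv_add:
  fixes F G H :: "'m \<Rightarrow> 'a::comm_ring_1"
  shows "(\<Sum>(k, l) | f k l = m. (F k + G k) * H l)
    = (\<Sum>(k, l) | f k l = m. F k * H l) + (\<Sum>(k, l) | f k l = m. G k * H l)"
  by (simp add: sum.distrib[symmetric] case_prod_unfold distrib_right)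

lemma conv_assoc:
  fixes F G H :: "'m \<Rightarrow> 'a::comm_ring_1"
  shows "(\<Sum>(k, l) | f k l = m. (\<Sum>(i, j) | f i j = k. F i * G j) * H l)
    = (\<Sum>(k, l) | f k l = m. F k * (\<Sum>(i, j) | f i j = l. G i * H j))"
proof -
  let ?D = "\<lambda>m. {(k, l). f k l = m}"
  have fin: "finite (?D n)" for n
    by (rule finite_factors)
  have "(\<Sum>(k, l) | f k l = m. (\<Sum>(i, j) | f i j = k. F i * G j) * H l)
      = (\<Sum>x \<in> ?D m. \<Sum>y \<in> ?D (fst x). F (fst y) * G (snd y) * H (snd x))"
    by (simp add: case_prod_unfold sum_distrib_right)
  also have "\<dots> = (\<Sum>(x, y) \<in> Sigma (?D m) (\<lambda>x. ?D (fst x)). F (fst y) * G (snd y) * H (snd x))"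
    by (rule sum.Sigma) (use fin in auto)
  also have "\<dots> = (\<Sum>(x, y) \<in> Sigma (?D m) (\<lambda>x. ?D (snd x)). F (fst x) * (G (fst y) * H (snd y)))"
    by (rule sum.reindex_bij_witness
          [where i = "\<lambda>((a, b), (c, d)). ((f a c, d), (a, c))"
             and j = "\<lambda>((a, b), (c, d)). ((c, f d b), (d, b))"])
       (auto simp: assoc mult.assoc)
  also have "\<dots> = (\<Sum>x \<in> ?D m. \<Sum>y \<in> ?D (snd x). F (fst x) * (G (fst y) * H (snd y)))"
    by (rule sum.Sigma[symmetric]) (use fin in auto)
  also have "\<dots> = (\<Sum>(k, l) | f k l = m. F k * (\<Sum>(i, j) | f i j = l. G i * H j))"
    by (simp add: case_prod_unfold sum_distrib_left)
  finally show ?thesis .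
qed

end


section \<open>Formal power series in the variables $x_0, x_1, \dots$\<close>

text \<open>
  Exponent vectors are finitely supported, but a series may have arbitrarily many nonzero
  coefficients. The power series in $h$ variables are those that involve $x_0, \dots, x_{h-1}$ only.
\<close>

typedef 'a mfps = "UNIV :: ((nat \<Rightarrow>\<^sub>0 nat) \<Rightarrow> 'a) set"
  morphisms mfps_nth Abs_mfps
  by simp

lemmas mfps_nth_Abs [simp] = Abs_mfps_inverse[OF UNIV_I]

lemma mfps_eqI: "(\<And>m. mfps_nth F m = mfps_nth G m) \<Longrightarrow> F = G"
  using mfps_nth_inject by blast

interpretation mfps: finite_factorisation "(+) :: (nat \<Rightarrow>\<^sub>0 nat) \<Rightarrow> _" 0
proof
  fix m :: "nat \<Rightarrow>\<^sub>0 nat"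
  let ?B = "\<Union>i\<in>Poly_Mapping.keys m. {..Poly_Mapping.lookup m i}"
  let ?S = "{g. \<forall>i. (i \<in> Poly_Mapping.keys m \<longrightarrow> g i \<in> ?B) \<and> (i \<notin> Poly_Mapping.keys m \<longrightarrow> g i = 0)}"
  have fin: "finite ?S"
    by (rule finite_set_of_finite_funs) auto
  have *: "Poly_Mapping.lookup k \<in> ?S" "Poly_Mapping.lookup l \<in> ?S" if "k + l = m" for k l
  proof -
    have eq: "Poly_Mapping.lookup m i = Poly_Mapping.lookup k i + Poly_Mapping.lookup l i" for i
      by (simp flip: that add: lookup_add)
    have le: "Poly_Mapping.lookup k i \<le> Poly_Mapping.lookup m i"
      "Poly_Mapping.lookup l i \<le> Poly_Mapping.lookup m i" for i
      by (simp_all add: eq)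
    have zero: "Poly_Mapping.lookup k i = 0" "Poly_Mapping.lookup l i = 0"
      if "i \<notin> Poly_Mapping.keys m" for i
      using that le[of i] by (simp_all add: in_keys_iff)
    show "Poly_Mapping.lookup k \<in> ?S" using le(1) zero(1) by auto
    show "Poly_Mapping.lookup l \<in> ?S" using le(2) zero(2) by auto
  qed
  have "finite (Poly_Mapping.lookup -` ?S)"
    by (rule finite_vimageI[OF fin]) (simp add: inj_on_def poly_mapping_eqI)
  then have "finite (Poly_Mapping.lookup -` ?S \<times> Poly_Mapping.lookup -` ?S)"
    by blast
  moreover have "{(k, l). k + l = m} \<subseteq> Poly_Mapping.lookup -` ?S \<times> Poly_Mapping.lookup -` ?S"
    using * by blast
  ultimately show "finite {(k, l). k + l = m}"
    by (rule rev_finite_subset)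
qed

instantiation mfps :: (comm_ring_1) comm_ring_1
begin

definition "0 = Abs_mfps (\<lambda>m. 0)"
definition "1 = Abs_mfps (\<lambda>m. if m = 0 then 1 else 0)"
definition "F + G = Abs_mfps (\<lambda>m. mfps_nth F m + mfps_nth G m)"
definition "F - G = Abs_mfps (\<lambda>m. mfps_nth F m - mfps_nth G m)"
definition "- F = Abs_mfps (\<lambda>m. - mfps_nth F m)"
definition "F * G = Abs_mfps (\<lambda>m. \<Sum>(k, l) | k + l = m. mfps_nth F k * mfps_nth G l)"

instance
proof
  fix F G H :: "'a mfps"
  note [simp] = zero_mfps_def one_mfps_def plus_mfps_def minus_mfps_def uminus_mfps_def times_mfps_def
  show "F + G + H = F + (G + H)" "F + G = G + F" "0 + F = F" "- F + F = 0" "F - G = F + - G"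
    by (simp_all add: add_ac mfps_nth_inverse)
  show "F * G * H = F * (G * H)" by (simp add: mfps.conv_assoc)
  show "F * G = G * F" using mfps.conv_commute[of "mfps_nth F" "mfps_nth G"] by simp
  show "1 * F = F" by (simp add: mfps.conv_one mfps_nth_inverse)
  show "(F + G) * H = F * H + G * H" by (simp add: mfps.conv_add)
  show "(0 :: 'a mfps) \<noteq> 1"
  proof
    assume "(0 :: 'a mfps) = 1"
    then have "mfps_nth (0 :: 'a mfps) 0 = mfps_nth 1 0" by simp
    then show False by simp
  qed
qed

end

text \<open>Series that are not units get the inverse \<open>0\<close>.\<close>

instantiation mfps :: (comm_ring_1) inverse
begin

definition "inverse (F :: 'a mfps) = (if F dvd 1 then THE G. F * G = 1 else 0)"
definition "F div (G :: 'a mfps) = F * inverse G"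

instance ..

end

lemma mfps_inverse_unique:
  fixes F G :: "'a::comm_ring_1 mfps"
  assumes "F * G = 1"
  shows "inverse F = G"
proof -
  have "(THE G. F * G = 1) = G"
  proof (rule the_equality)
    show "F * G = 1" by (rule assms)
  next
    fix G' assume *: "F * G' = 1"
    have "G' = (F * G) * G'" using assms by simp
    also have "\<dots> = G * (F * G')" by (simp only: mult.commute[of F G] mult.assoc)
    also have "\<dots> = G" using * by simp
    finally show "G' = G" .
  qed
  moreover have "F dvd 1" unfolding dvd_def using assms by metis
  ultimately show ?thesis by (simp add: inverse_mfps_def)
qed

definition mfps_X :: "nat \<Rightarrow> 'a::comm_ring_1 mfps" where
  "mfps_X i = Abs_mfps (\<lambda>m. if m = Poly_Mapping.single i 1 then 1 else 0)"

text \<open>A family has a formal sum if each coefficient receives finitely many contributions.\<close>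

definition mfps_summable_on :: "('i \<Rightarrow> 'a::comm_ring_1 mfps) \<Rightarrow> 'i set \<Rightarrow> bool" where
  "mfps_summable_on F I \<longleftrightarrow> (\<forall>m. finite {i \<in> I. mfps_nth (F i) m \<noteq> 0})"

definition mfps_infsum :: "('i \<Rightarrow> 'a::comm_ring_1 mfps) \<Rightarrow> 'i set \<Rightarrow> 'a mfps" where
  "mfps_infsum F I = Abs_mfps (\<lambda>m. \<Sum>i | i \<in> I \<and> mfps_nth (F i) m \<noteq> 0. mfps_nth (F i) m)"

definition mfps_has_sum :: "('i \<Rightarrow> 'a::comm_ring_1 mfps) \<Rightarrow> 'i set \<Rightarrow> 'a mfps \<Rightarrow> bool" where
  "mfps_has_sum F I S \<longleftrightarrow> mfps_summable_on F I \<and> S = mfps_infsum F I"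


section \<open>Formal Dirichlet series in the variables $s_0, s_1, \dots$\<close>

text \<open>
  A basis monomial $n_0^{-s_0} n_1^{-s_1} \cdots$ is indexed by a sequence of positive integers,
  all but finitely many equal to $1$.
\<close>

typedef dirichlet_index = "{n :: nat \<Rightarrow> nat. (\<forall>i. 0 < n i) \<and> finite {i. n i \<noteq> 1}}"
  morphisms base Abs_dirichlet_index
  by (rule exI[of _ "\<lambda>_. 1"]) simp

lemma base_pos: "0 < base n i"
  and finite_base: "finite {i. base n i \<noteq> 1}"
  using base[of n] by auto

lemma dirichlet_index_eqI: "(\<And>i. base m i = base n i) \<Longrightarrow> m = n"
  using base_inject by blast

instantiation dirichlet_index :: comm_monoid_mult
begin

definition "1 = Abs_dirichlet_index (\<lambda>i. 1)"
definition "m * n = Abs_dirichlet_index (\<lambda>i. base m i * base n i)"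

lemma base_one [simp]: "base 1 i = 1"
  by (simp add: one_dirichlet_index_def Abs_dirichlet_index_inverse)

lemma base_times [simp]: "base (m * n) i = base m i * base n i"
proof -
  have "finite {i. base m i * base n i \<noteq> 1}"
    by (rule finite_subset[OF _ finite_UnI[OF finite_base[of m] finite_base[of n]]]) auto
  then show ?thesis
    by (simp add: times_dirichlet_index_def Abs_dirichlet_index_inverse base_pos)
qed

instance
  by standard (auto intro!: dirichlet_index_eqI)

end

typedef 'a mds = "UNIV :: (dirichlet_index \<Rightarrow> 'a) set"
  morphisms mds_nth Abs_mds
  by simp

lemmas mds_nth_Abs [simp] = Abs_mds_inverse[OF UNIV_I]

lemma mds_eqI: "(\<And>m. mds_nth F m = mds_nth G m) \<Longrightarrow> F = G"
  using mds_nth_inject by blast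

interpretation mds: finite_factorisation "(*) :: dirichlet_index \<Rightarrow> _" 1
proof
  fix m :: dirichlet_index
  let ?A = "{i. base m i \<noteq> 1}"
  let ?B = "\<Union>i\<in>?A. {..base m i}"
  let ?S = "{g. \<forall>i. (i \<in> ?A \<longrightarrow> g i \<in> ?B) \<and> (i \<notin> ?A \<longrightarrow> g i = 1)}"
  have fin: "finite ?S"
    by (rule finite_set_of_finite_funs) (use finite_base[of m] in auto)
  have *: "base k \<in> ?S" if "k dvd m" for k
  proof -
    have d: "base k i dvd base m i" for i
      using that by (auto elim: dvdE)
    then have le: "base k i \<le> base m i" for i
      by (meson base_pos dvd_imp_le)
    have "base k i = 1" if "i \<notin> ?A" for i
      using d[of i] that by simp
    with le show ?thesis by auto
  qed
  have "finite (base -` ?S)"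
    by (rule finite_vimageI[OF fin]) (simp add: inj_on_def base_inject)
  then have "finite (base -` ?S \<times> base -` ?S)"
    by blast
  moreover have "(k, l) \<in> base -` ?S \<times> base -` ?S" if "k * l = m" for k l
  proof -
    have "k dvd m" "l dvd m" by (simp_all flip: that)
    then show ?thesis by (intro SigmaI vimageI2 *)
  qed
  then have "{(k, l). k * l = m} \<subseteq> base -` ?S \<times> base -` ?S"
    by (auto simp only: mem_Collect_eq case_prod_conv)
  ultimately show "finite {(k, l). k * l = m}"
    by (rule rev_finite_subset)
qed

instantiation mds :: (comm_ring_1) comm_ring_1
begin

definition "0 = Abs_mds (\<lambda>n. 0)"
definition "1 = Abs_mds (\<lambda>n. if n = 1 then 1 else 0)"
definition "F + G = Abs_mds (\<lambda>n. mds_nth F n + mds_nth G n)"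
definition "F - G = Abs_mds (\<lambda>n. mds_nth F n - mds_nth G n)"
definition "- F = Abs_mds (\<lambda>n. - mds_nth F n)"
definition "F * G = Abs_mds (\<lambda>n. \<Sum>(k, l) | k * l = n. mds_nth F k * mds_nth G l)"

instance
proof
  fix F G H :: "'a mds"
  note [simp] = zero_mds_def one_mds_def plus_mds_def minus_mds_def uminus_mds_def times_mds_def
  show "F + G + H = F + (G + H)" "F + G = G + F" "0 + F = F" "- F + F = 0" "F - G = F + - G"
    by (simp_all add: add_ac mds_nth_inverse)
  show "F * G * H = F * (G * H)" by (simp add: mds.conv_assoc)
  show "F * G = G * F" using mds.conv_commute[of "mds_nth F" "mds_nth G"] by simp
  show "1 * F = F" by (simp add: mds.conv_one mds_nth_inverse)
  show "(F + G) * H = F * H + G * H" by (simp add: mds.conv_add)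
  show "(0 :: 'a mds) \<noteq> 1"
  proof
    assume "(0 :: 'a mds) = 1"
    then have "mds_nth (0 :: 'a mds) 1 = mds_nth 1 1" by simp
    then show False by simp
  qed
qed

end

text \<open>\<open>mds_pow i n\<close> is $n^{-s_i}$; the value for \<open>n = 0\<close> is \<open>0\<close>.\<close>

definition mds_pow :: "nat \<Rightarrow> nat \<Rightarrow> 'a::comm_ring_1 mds" where
  "mds_pow i n = Abs_mds (\<lambda>k. if base k = (\<lambda>j. if j = i then n else 1) then 1 else 0)"

lemma mds_pow_mult:
  assumes "0 < m" "0 < n"
  shows "mds_pow i m * mds_pow i n = (mds_pow i (m * n) :: 'a::comm_ring_1 mds)"
proof (rule mds_eqI)
  fix r
  define c where "c a = Abs_dirichlet_index (\<lambda>j. if j = i then a else 1)" for a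
  have c: "base (c a) = (\<lambda>j. if j = i then a else 1)" if "0 < a" for a
    unfolding c_def using that by (subst Abs_dirichlet_index_inverse) (auto intro: finite_subset[of _ "{i}"])
  have iff: "base k = (\<lambda>j. if j = i then a else 1) \<longleftrightarrow> k = c a" if "0 < a" for a k
    using c[OF that] base_inject by metis
  have cc: "c m * c n = c (m * n)"
    by (rule dirichlet_index_eqI) (simp add: c assms)
  have "mds_nth (mds_pow i m * mds_pow i n :: 'a mds) r
      = (\<Sum>(k, l) | k * l = r. (if k = c m then 1 else 0) * (if l = c n then 1 else 0))"
    by (simp add: times_mds_def mds_pow_def iff assms)
  also have "\<dots> = (\<Sum>(k, l) \<in> {(k, l). k * l = r} \<inter> {(c m, c n)}.
      (if k = c m then 1 else 0) * (if l = c n then 1 else 0))"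
    by (rule sum.mono_neutral_right) (use mds.finite_factors[of r] in \<open>auto split: if_splits\<close>)
  also have "\<dots> = (if r = c (m * n) then 1 else 0)"
    by (auto simp: cc)
  also have "\<dots> = mds_nth (mds_pow i (m * n)) r"
    by (simp add: mds_pow_def iff assms)
  finally show "mds_nth (mds_pow i m * mds_pow i n :: 'a mds) r = mds_nth (mds_pow i (m * n)) r" .
qed

definition mds_infsum :: "('i \<Rightarrow> 'a::comm_ring_1 mds) \<Rightarrow> 'i set \<Rightarrow> 'a mds" where
  "mds_infsum F I = Abs_mds (\<lambda>n. \<Sum>i | i \<in> I \<and> mds_nth (F i) n \<noteq> 0. mds_nth (F i) n)"


section \<open>Espaliers and pyramids\<close>

type_synonym cell = "int \<times> int \<times> int"

definition layer :: "int \<Rightarrow> int \<Rightarrow> nat \<Rightarrow> nat \<Rightarrow> (int \<times> int) set" where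
  "layer b c p q = {b..<b + int p} \<times> {c..<c + int q}"

definition stack :: "nat \<Rightarrow> (nat \<Rightarrow> int) \<Rightarrow> (nat \<Rightarrow> int) \<Rightarrow> (nat \<Rightarrow> nat) \<Rightarrow> (nat \<Rightarrow> nat) \<Rightarrow> cell set" where
  "stack h b c p q = (\<Union>a<h. {int a} \<times> layer (b a) (c a) (p a) (q a))"

definition espaliers :: "nat \<Rightarrow> cell set set" where
  "espaliers h = {stack h (\<lambda>_. 0) (\<lambda>_. 0) p q | p q.
     (\<forall>a<h. 1 \<le> p a \<and> 1 \<le> q a) \<and>
     (\<forall>a. 1 \<le> a \<and> a < h \<longrightarrow> p a \<le> p (a - 1) \<and> q a \<le> q (a - 1))}"

definition pyramids :: "nat \<Rightarrow> cell set set" where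
  "pyramids h = {stack h b c p q | b c p q.
     b 0 = 0 \<and> c 0 = 0 \<and> (\<forall>a<h. 1 \<le> p a \<and> 1 \<le> q a) \<and>
     (\<forall>a. 1 \<le> a \<and> a < h \<longrightarrow>
        layer (b a) (c a) (p a) (q a) \<subseteq> layer (b (a - 1)) (c (a - 1)) (p (a - 1)) (q (a - 1)))}"

lemma espaliers_subset_pyramids: "espaliers h \<subseteq> pyramids h"
proof
  fix S assume "S \<in> espaliers h"
  then obtain p q where S: "S = stack h (\<lambda>_. 0) (\<lambda>_. 0) p q" "\<forall>a<h. 1 \<le> p a \<and> 1 \<le> q a"
    and dec: "\<forall>a. 1 \<le> a \<and> a < h \<longrightarrow> p a \<le> p (a - 1) \<and> q a \<le> q (a - 1)"
    by (auto simp: espaliers_def)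
  have "\<forall>a. 1 \<le> a \<and> a < h \<longrightarrow> layer 0 0 (p a) (q a) \<subseteq> layer 0 0 (p (a - 1)) (q (a - 1))"
    using dec unfolding layer_def by (intro allI impI Sigma_mono) auto
  then show "S \<in> pyramids h"
    unfolding pyramids_def using S
    by (intro CollectI exI[of _ "\<lambda>_. 0"] exI[of _ p] exI[of _ q]) simp
qed

definition plateau :: "nat \<Rightarrow> cell set \<Rightarrow> cell set" where
  "plateau a S = {x \<in> S. fst x = int a}"

lemma card_plateau:
  assumes "a < h"
  shows "card (plateau a (stack h b c p q)) = p a * q a"
proof -
  have "plateau a (stack h b c p q) = {int a} \<times> layer (b a) (c a) (p a) (q a)"
    using assms by (auto simp: plateau_def stack_def)
  then show ?thesis
    by (simp add: layer_def card_cartesian_product)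
qed

text \<open>Plateau volumes are given as a list, whose length is the height.\<close>

definition espalier_count :: "nat list \<Rightarrow> nat" where
  "espalier_count m = card {S \<in> espaliers (length m). \<forall>a<length m. card (plateau a S) = m ! a}"

definition pyramid_count :: "nat list \<Rightarrow> nat" where
  "pyramid_count m = card {S \<in> pyramids (length m). \<forall>a<length m. card (plateau a S) = m ! a}"


section \<open>Generating functions\<close>

definition decreasing_lists :: "nat \<Rightarrow> nat list set" where
  "decreasing_lists h = {n. length n = h \<and> sorted_wrt (\<ge>) n \<and> (\<forall>k\<in>set n. 1 \<le> k)}"

text \<open>$(n_1-n_2+1)\cdots(n_{h-1}-n_h+1)$\<close>

definition gap_product :: "nat list \<Rightarrow> int" where
  "gap_product n = (\<Prod>i<length n - 1. int (n ! i) - int (n ! Suc i) + 1)"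

text \<open>
  In the following sums, distinct lists give distinct monomials, so that each coefficient
  receives at most one contribution.
\<close>

definition espalier_gf :: "nat \<Rightarrow> int mfps" where
  "espalier_gf h = mfps_infsum
     (\<lambda>m. of_nat (espalier_count m) * (\<Prod>i<h. mfps_X i ^ (m ! i))) (decreasing_lists h)"

definition pyramid_gf :: "nat \<Rightarrow> int mfps" where
  "pyramid_gf h = mfps_infsum
     (\<lambda>m. of_nat (pyramid_count m) * (\<Prod>i<h. mfps_X i ^ (m ! i))) (decreasing_lists h)"

definition espalier_dirichlet :: "nat \<Rightarrow> int mds" where
  "espalier_dirichlet h = mds_infsum
     (\<lambda>m. of_nat (espalier_count m) * (\<Prod>i<h. mds_pow i (m ! i))) (decreasing_lists h)"

definition pyramid_dirichlet :: "nat \<Rightarrow> int mds" where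
  "pyramid_dirichlet h = mds_infsum
     (\<lambda>m. of_nat (pyramid_count m) * (\<Prod>i<h. mds_pow i (m ! i))) (decreasing_lists h)"

definition multizeta :: "nat \<Rightarrow> int mds" where
  "multizeta h = mds_infsum (\<lambda>n. \<Prod>i<h. mds_pow i (n ! i)) (decreasing_lists h)"

definition multizeta_gap :: "nat \<Rightarrow> int mds" where
  "multizeta_gap h = mds_infsum
     (\<lambda>n. of_int (gap_product n) * (\<Prod>i<h. mds_pow i (n ! i))) (decreasing_lists h)"

end

theory Submission
  imports Defs
begin

text \<open>
  A pyramid with plateau volumes \<open>m\<close> is given by two decreasing sequences \<open>p\<close>, \<open>q\<close> with
  \<open>p\<^sub>i q\<^sub>i = m\<^sub>i\<close> together with a position of each plateau on the one below. The two coordinates of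
  the positions are independent, and there are \<open>p\<^sub>i - p\<^sub>i\<^sub>+\<^sub>1 + 1\<close> choices for each step in the first
  and \<open>q\<^sub>i - q\<^sub>i\<^sub>+\<^sub>1 + 1\<close> in the second. So the number of pyramids is the sum of \<open>w p * w q\<close> over the
  factorisations of \<open>m\<close>, with \<open>w\<close> the gap product; for espaliers take \<open>w = 1\<close>. This is
  exactly the coefficient of a square of Dirichlet series. For the power series, fix \<open>p\<close> and sum over
  the gaps of \<open>q\<close>, which are independent; each gap contributes a geometric series
  \<open>\<Sum>k. y ^ k\<close>, or \<open>\<Sum>k. (k + 1) * y ^ k\<close> in the weighted case.
\<close>

section \<open>Formal sums of power series\<close>

text \<open>The only factorisation that contributes is \<open>(a, b)\<close>. Stated in the locale
  so that it gives the product of monomials both for power series and for Dirichlet series.\<close>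

lemma (in finite_factorisation) conv_monom:
  fixes c d :: "'a::comm_ring_1"
  shows "(\<Sum>(k, l) | f k l = m. (if k = a then c else 0) * (if l = b then d else 0))
    = (if m = f a b then c * d else 0)"
proof -
  have "(\<Sum>(k, l) | f k l = m. (if k = a then c else 0) * (if l = b then d else 0))
      = (\<Sum>(k, l) \<in> {(k, l). f k l = m} \<inter> {(a, b)}.
          (if k = a then c else 0) * (if l = b then d else 0))"
    by (rule sum.mono_neutral_right) (use finite_factors[of m] in \<open>auto split: if_splits\<close>)
  also have "\<dots> = (if m = f a b then c * d else 0)"
    by auto
  finally show ?thesis .
qed

lemma mfps_nth_minus: "mfps_nth (F - G) m = mfps_nth F m - mfps_nth G m"
  by (simp add: minus_mfps_def)

lemma mfps_nth_times:
  "mfps_nth (F * G) m = (\<Sum>(k, l) | k + l = m. mfps_nth F k * mfps_nth G l)"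
  by (simp add: times_mfps_def)

lemma mfps_has_sum_imp_finite:
  "mfps_has_sum F I S \<Longrightarrow> finite {i \<in> I. mfps_nth (F i) m \<noteq> 0}"
  by (simp add: mfps_has_sum_def mfps_summable_on_def)

text \<open>\<open>A\<close> may be any finite index set containing the nonzero contributions, so
  several families can be summed over a common set.\<close>

lemma mfps_has_sum_nth:
  assumes "mfps_has_sum F I S" "finite A" "A \<subseteq> I"
    and "\<And>i. i \<in> I \<Longrightarrow> i \<notin> A \<Longrightarrow> mfps_nth (F i) m = 0"
  shows "mfps_nth S m = (\<Sum>i\<in>A. mfps_nth (F i) m)"
proof -
  have "mfps_nth S m = (\<Sum>i | i \<in> I \<and> mfps_nth (F i) m \<noteq> 0. mfps_nth (F i) m)"
    using assms(1) by (simp add: mfps_has_sum_def mfps_infsum_def)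
  also have "\<dots> = (\<Sum>i\<in>A. mfps_nth (F i) m)"
    by (rule sum.mono_neutral_left) (use assms in auto)
  finally show ?thesis .
qed

text \<open>The set \<open>A\<close> may depend on \<open>m\<close> and may contain vanishing terms,
  so the exact support of a coefficient need not be computed.\<close>

lemma mfps_has_sumI:
  assumes "\<And>m. \<exists>A. finite A \<and> A \<subseteq> I \<and> (\<forall>i\<in>I - A. mfps_nth (F i) m = 0) \<and>
      mfps_nth S m = (\<Sum>i\<in>A. mfps_nth (F i) m)"
  shows "mfps_has_sum F I S"
  unfolding mfps_has_sum_def
proof
  have "finite {i \<in> I. mfps_nth (F i) m \<noteq> 0}" for m
  proof -
    obtain A where "finite A" "\<forall>i\<in>I - A. mfps_nth (F i) m = 0"
      using assms by meson
    then show ?thesis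
      by (elim finite_subset[rotated]) auto
  qed
  then show summable: "mfps_summable_on F I"
    by (simp add: mfps_summable_on_def)
  show "S = mfps_infsum F I"
  proof (rule mfps_eqI)
    fix m
    obtain A where A: "finite A" "A \<subseteq> I" "\<forall>i\<in>I - A. mfps_nth (F i) m = 0"
      "mfps_nth S m = (\<Sum>i\<in>A. mfps_nth (F i) m)"
      using assms by meson
    have "mfps_has_sum F I (mfps_infsum F I)"
      using summable by (simp add: mfps_has_sum_def)
    from mfps_has_sum_nth[OF this A(1,2), of m] A(3,4)
    show "mfps_nth S m = mfps_nth (mfps_infsum F I) m" by simp
  qed
qed

lemma mfps_has_sum_unique: "mfps_has_sum F I S \<Longrightarrow> mfps_has_sum F I T \<Longrightarrow> S = T"
  by (simp add: mfps_has_sum_def)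

lemma mfps_infsum_cong:
  assumes "\<And>i. i \<in> I \<Longrightarrow> F i = G i"
  shows "mfps_infsum F I = mfps_infsum G I"
  unfolding mfps_infsum_def using assms by (intro arg_cong[of _ _ Abs_mfps] ext sum.cong) auto

lemma mfps_has_sum_cong:
  assumes "\<And>i. i \<in> I \<Longrightarrow> F i = G i"
  shows "mfps_has_sum F I S \<longleftrightarrow> mfps_has_sum G I S"
proof -
  have "{i \<in> I. mfps_nth (F i) m \<noteq> 0} = {i \<in> I. mfps_nth (G i) m \<noteq> 0}" for m
    using assms by auto
  then show ?thesis
    using mfps_infsum_cong[of I F G] assms by (simp add: mfps_has_sum_def mfps_summable_on_def)
qed

lemma mfps_has_sum_finite:
  assumes "finite I"
  shows "mfps_has_sum F I (\<Sum>i\<in>I. F i)"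
proof -
  have "mfps_nth (\<Sum>i\<in>I. F i) m = (\<Sum>i\<in>I. mfps_nth (F i) m)" for m
    using assms by induction (simp_all add: zero_mfps_def plus_mfps_def)
  then show ?thesis
    using assms by (intro mfps_has_sumI exI[of _ I]) auto
qed

lemma mfps_has_sum_reindex:
  assumes "bij_betw g I J" "mfps_has_sum F J S"
  shows "mfps_has_sum (\<lambda>i. F (g i)) I S"
proof (rule mfps_has_sumI)
  fix m
  let ?A = "{j \<in> J. mfps_nth (F j) m \<noteq> 0}" and ?B = "{i \<in> I. mfps_nth (F (g i)) m \<noteq> 0}"
  have bij: "bij_betw g ?B ?A"
    using assms(1) unfolding bij_betw_def by (auto simp: inj_on_def image_iff)
  have fin: "finite ?A"
    using assms(2) by (rule mfps_has_sum_imp_finite)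
  have "mfps_nth S m = (\<Sum>j\<in>?A. mfps_nth (F j) m)"
    by (rule mfps_has_sum_nth[OF assms(2) fin]) auto
  also have "\<dots> = (\<Sum>i\<in>?B. mfps_nth (F (g i)) m)"
    by (rule sum.reindex_bij_betw[OF bij, symmetric])
  finally show "\<exists>A. finite A \<and> A \<subseteq> I \<and> (\<forall>i\<in>I - A. mfps_nth (F (g i)) m = 0) \<and>
      mfps_nth S m = (\<Sum>i\<in>A. mfps_nth (F (g i)) m)"
    using bij_betw_finite[OF bij] fin by (intro exI[of _ ?B]) auto
qed

lemma mfps_has_sum_diff:
  assumes "mfps_has_sum F I S" "mfps_has_sum G I T"
  shows "mfps_has_sum (\<lambda>i. F i - G i) I (S - T)"
proof (rule mfps_has_sumI)
  fix m
  let ?A = "{i \<in> I. mfps_nth (F i) m \<noteq> 0} \<union> {i \<in> I. mfps_nth (G i) m \<noteq> 0}"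
  have fin: "finite ?A"
    using assms by (simp add: mfps_has_sum_imp_finite)
  have "mfps_nth S m = (\<Sum>i\<in>?A. mfps_nth (F i) m)"
    by (rule mfps_has_sum_nth[OF assms(1) fin]) auto
  moreover have "mfps_nth T m = (\<Sum>i\<in>?A. mfps_nth (G i) m)"
    by (rule mfps_has_sum_nth[OF assms(2) fin]) auto
  ultimately show "\<exists>A. finite A \<and> A \<subseteq> I \<and> (\<forall>i\<in>I - A. mfps_nth (F i - G i) m = 0) \<and>
      mfps_nth (S - T) m = (\<Sum>i\<in>A. mfps_nth (F i - G i) m)"
    using fin by (intro exI[of _ ?A]) (auto simp: mfps_nth_minus sum_subtractf)
qed

text \<open>A coefficient of the product involves only finitely many splittings
  \<open>k + l = m\<close>. \<open>A\<close> and \<open>B\<close> collect the indices that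
  contribute to some splitting; a pair outside \<open>A \<times> B\<close> contributes to
  none.\<close>

lemma mfps_has_sum_times:
  assumes F: "mfps_has_sum F I S" and G: "mfps_has_sum G J T"
  shows "mfps_has_sum (\<lambda>(i, j). F i * G j) (I \<times> J) (S * T)"
proof (rule mfps_has_sumI)
  fix m
  let ?D = "{(k :: nat \<Rightarrow>\<^sub>0 nat, l). k + l = m}"
  define A where "A = (\<Union>(k, l)\<in>?D. {i \<in> I. mfps_nth (F i) k \<noteq> 0})"
  define B where "B = (\<Union>(k, l)\<in>?D. {j \<in> J. mfps_nth (G j) l \<noteq> 0})"
  have finD: "finite ?D"
    by (rule mfps.finite_factors)
  have fin: "finite A" "finite B"
    unfolding A_def B_def using finD
    by (auto intro!: finite_UN_I mfps_has_sum_imp_finite[OF F] mfps_has_sum_imp_finite[OF G])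
  have S: "mfps_nth S k = (\<Sum>i\<in>A. mfps_nth (F i) k)" if "(k, l) \<in> ?D" for k l
    by (rule mfps_has_sum_nth[OF F fin(1)]) (use that in \<open>auto simp: A_def\<close>)
  have T: "mfps_nth T l = (\<Sum>j\<in>B. mfps_nth (G j) l)" if "(k, l) \<in> ?D" for k l
    by (rule mfps_has_sum_nth[OF G fin(2)]) (use that in \<open>auto simp: B_def\<close>)
  have "mfps_nth (S * T) m = (\<Sum>(k, l)\<in>?D. \<Sum>(i, j)\<in>A \<times> B. mfps_nth (F i) k * mfps_nth (G j) l)"
    unfolding mfps_nth_times
    by (intro sum.cong) (auto simp: S T sum_product sum.cartesian_product)
  also have "\<dots> = (\<Sum>(i, j)\<in>A \<times> B. mfps_nth (F i * G j) m)"
    unfolding mfps_nth_times case_prod_unfold by (rule sum.swap)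
  finally have sum: "mfps_nth (S * T) m = (\<Sum>(i, j)\<in>A \<times> B. mfps_nth (F i * G j) m)" .
  have zero: "mfps_nth (F i * G j) m = 0" if "(i, j) \<in> I \<times> J - A \<times> B" for i j
    unfolding mfps_nth_times
    by (rule sum.neutral) (use that in \<open>auto simp: A_def B_def\<close>)
  show "\<exists>C. finite C \<and> C \<subseteq> I \<times> J \<and>
      (\<forall>x\<in>I \<times> J - C. mfps_nth (case x of (i, j) \<Rightarrow> F i * G j) m = 0) \<and>
      mfps_nth (S * T) m = (\<Sum>x\<in>C. mfps_nth (case x of (i, j) \<Rightarrow> F i * G j) m)"
  proof (intro exI conjI ballI)
    show "A \<times> B \<subseteq> I \<times> J"
      by (auto simp: A_def B_def)
    show "mfps_nth (S * T) m = (\<Sum>x\<in>A \<times> B. mfps_nth (case x of (i, j) \<Rightarrow> F i * G j) m)"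
      using sum by (simp add: case_prod_unfold)
  qed (use zero fin in auto)
qed

lemma mfps_has_sum_cmult:
  assumes "mfps_has_sum F I S"
  shows "mfps_has_sum (\<lambda>i. c * F i) I (c * S)"
proof -
  have "mfps_has_sum (\<lambda>(_, i). c * F i) ({()} \<times> I) (c * S)"
    using mfps_has_sum_times[OF mfps_has_sum_finite[of "{()}" "\<lambda>_. c"] assms] by simp
  moreover have "bij_betw (Pair ()) I ({()} \<times> I)"
    by (auto simp: bij_betw_def inj_on_def)
  ultimately show ?thesis
    using mfps_has_sum_reindex by fastforce
qed

text \<open>Summability of the whole family is assumed because it does not follow from that of the
  rows and of their sums: terms may cancel within a row.\<close>

lemma mfps_has_sum_Sigma:
  assumes total: "mfps_has_sum (\<lambda>(i, j). F i j) (Sigma I J) S"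
    and inner: "\<And>i. i \<in> I \<Longrightarrow> mfps_has_sum (F i) (J i) (T i)"
  shows "mfps_has_sum T I S"
proof (rule mfps_has_sumI)
  fix m
  let ?K = "\<lambda>i. {j \<in> J i. mfps_nth (F i j) m \<noteq> 0}"
  let ?X = "{x \<in> Sigma I J. mfps_nth (case x of (i, j) \<Rightarrow> F i j) m \<noteq> 0}"
  \<comment> \<open>The rows with a nonzero term at \<open>m\<close>. In every other row all terms,
    hence the row sum, vanish there.\<close>
  define A where "A = fst ` ?X"
  have finX: "finite ?X"
    using total by (rule mfps_has_sum_imp_finite)
  have A: "finite A" "A \<subseteq> I"
    using finX by (auto simp: A_def)
  have finK: "finite (?K i)" if "i \<in> I" for i
    using inner[OF that] by (rule mfps_has_sum_imp_finite)
  have T: "mfps_nth (T i) m = (\<Sum>j\<in>?K i. mfps_nth (F i j) m)" if "i \<in> I" for i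
    by (rule mfps_has_sum_nth[OF inner[OF that] finK[OF that]]) auto
  have "mfps_nth (T i) m = 0" if "i \<in> I - A" for i
  proof -
    have "?K i = {}" using that by (force simp: A_def)
    then show ?thesis using T[of i] that by (metis DiffD1 sum.empty)
  qed
  moreover have "mfps_nth S m = (\<Sum>i\<in>A. mfps_nth (T i) m)"
  proof -
    have "mfps_nth S m = (\<Sum>x\<in>?X. mfps_nth (case x of (i, j) \<Rightarrow> F i j) m)"
      by (rule mfps_has_sum_nth[OF total finX]) auto
    also have "\<dots> = (\<Sum>(i, j)\<in>Sigma A ?K. mfps_nth (F i j) m)"
      by (rule sum.cong) (force simp: A_def)+
    also have "\<dots> = (\<Sum>i\<in>A. \<Sum>j\<in>?K i. mfps_nth (F i j) m)"
      by (rule sum.Sigma[symmetric]) (use A finK in auto)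
    also have "\<dots> = (\<Sum>i\<in>A. mfps_nth (T i) m)"
      by (rule sum.cong) (use A T in auto)
    finally show ?thesis .
  qed
  ultimately show "\<exists>A. finite A \<and> A \<subseteq> I \<and> (\<forall>i\<in>I - A. mfps_nth (T i) m = 0) \<and>
      mfps_nth S m = (\<Sum>i\<in>A. mfps_nth (T i) m)"
    using A by (intro exI[of _ A]) auto
qed

text \<open>The \<open>h\<close>-fold distributive law, with lists of length \<open>h\<close> as
  points of the product index set; the induction splits off the last entry.\<close>

lemma mfps_has_sum_prod:
  fixes F :: "nat \<Rightarrow> 'i \<Rightarrow> 'a::comm_ring_1 mfps"
  assumes "\<And>j. j < h \<Longrightarrow> mfps_has_sum (F j) UNIV (S j)"
  shows "mfps_has_sum (\<lambda>ks. \<Prod>j<h. F j (ks ! j)) {ks. length ks = h} (\<Prod>j<h. S j)"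
  using assms
proof (induction h)
  case 0
  show ?case
    using mfps_has_sum_finite[of "{[]}" "\<lambda>ks. \<Prod>j<0. F j (ks ! j)"] by simp
next
  case (Suc h)
  let ?g = "\<lambda>ks. (take h ks, ks ! h)"
  have "bij_betw ?g {ks. length ks = Suc h} ({ks. length ks = h} \<times> UNIV)"
    by (rule bij_betw_byWitness[where f' = "\<lambda>(ks, k). ks @ [k]"])
       (auto simp: take_Suc_conv_app_nth[symmetric])
  moreover have "mfps_has_sum (\<lambda>(ks, k). (\<Prod>j<h. F j (ks ! j)) * F h k)
      ({ks. length ks = h} \<times> UNIV) ((\<Prod>j<h. S j) * S h)"
    using Suc by (intro mfps_has_sum_times) auto
  ultimately have "mfps_has_sum (\<lambda>ks. case ?g ks of (ks, k) \<Rightarrow> (\<Prod>j<h. F j (ks ! j)) * F h k)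
      {ks. length ks = Suc h} ((\<Prod>j<h. S j) * S h)"
    by (rule mfps_has_sum_reindex)
  then show ?case by simp
qed

lemma mfps_has_sum_Suc:
  assumes "mfps_has_sum F (UNIV :: nat set) S"
  shows "mfps_has_sum (\<lambda>k. F (Suc k)) UNIV (S - F 0)"
proof -
  \<comment> \<open>The family concentrated at index \<open>0\<close>; subtracting it removes the
    first term, after which the index can be shifted.\<close>
  let ?G = "\<lambda>k. if k = 0 then F 0 else 0"
  have "mfps_has_sum ?G UNIV (F 0)"
    by (rule mfps_has_sumI, rule exI[of _ "{0}"]) (auto simp: zero_mfps_def)
  from mfps_has_sum_diff[OF assms this]
  have diff: "mfps_has_sum (\<lambda>k. F k - ?G k) UNIV (S - F 0)" .
  show ?thesis
  proof (rule mfps_has_sumI)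
    fix m
    let ?A = "{k. mfps_nth (F (Suc k)) m \<noteq> 0}"
    have "Suc ` ?A \<subseteq> {k \<in> UNIV. mfps_nth (F k) m \<noteq> 0}"
      by auto
    then have "finite (Suc ` ?A)"
      using mfps_has_sum_imp_finite[OF assms] finite_subset by blast
    then have fin: "finite ?A"
      by (simp add: finite_image_iff)
    have "mfps_nth (S - F 0) m = (\<Sum>k\<in>Suc ` ?A. mfps_nth (F k - ?G k) m)"
    proof (rule mfps_has_sum_nth[OF diff])
      fix k assume "k \<notin> Suc ` ?A"
      then show "mfps_nth (F k - ?G k) m = 0"
        by (cases k) (auto simp: mfps_nth_minus zero_mfps_def)
    qed (use fin in auto)
    also have "\<dots> = (\<Sum>k\<in>?A. mfps_nth (F (Suc k)) m)"
      by (subst sum.reindex) auto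
    finally show "\<exists>A. finite A \<and> A \<subseteq> UNIV \<and> (\<forall>k\<in>UNIV - A. mfps_nth (F (Suc k)) m = 0) \<and>
        mfps_nth (S - F 0) m = (\<Sum>k\<in>A. mfps_nth (F (Suc k)) m)"
      using fin by (intro exI[of _ ?A]) auto
  qed
qed


section \<open>Monomials and geometric series\<close>

definition mfps_monom :: "'a::comm_ring_1 \<Rightarrow> (nat \<Rightarrow>\<^sub>0 nat) \<Rightarrow> 'a mfps" where
  "mfps_monom c e = Abs_mfps (\<lambda>m. if m = e then c else 0)"

lemma mfps_nth_monom: "mfps_nth (mfps_monom c e) m = (if m = e then c else 0)"
  by (simp add: mfps_monom_def)

lemma mfps_monom_times: "mfps_monom c e * mfps_monom d f = mfps_monom (c * d) (e + f)"
  by (rule mfps_eqI) (simp add: mfps_nth_times mfps_nth_monom mfps.conv_monom)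

lemma mfps_monom_one: "mfps_monom 1 0 = 1"
  by (simp add: mfps_monom_def one_mfps_def)

lemma mfps_monom_diff: "mfps_monom c e - mfps_monom d e = mfps_monom (c - d) e"
  by (rule mfps_eqI) (simp add: mfps_nth_minus mfps_nth_monom)

lemma mfps_monom_sum: "(\<Sum>i\<in>A. mfps_monom (c i) e) = mfps_monom (\<Sum>i\<in>A. c i) e"
  by (induction A rule: infinite_finite_induct)
     (auto intro!: mfps_eqI simp: mfps_nth_monom zero_mfps_def plus_mfps_def)

lemma of_int_mfps: "(of_int c :: 'a::comm_ring_1 mfps) = mfps_monom (of_int c) 0"
proof -
  have nat: "(of_nat n :: 'a mfps) = mfps_monom (of_nat n) 0" for n
    by (induction n) (auto intro!: mfps_eqI simp: mfps_nth_monom zero_mfps_def plus_mfps_def one_mfps_def)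
  show ?thesis
  proof (cases c)
    case (nonneg n)
    then show ?thesis by (simp add: nat)
  next
    case (neg n)
    have "(of_int c :: 'a mfps) = - of_nat (Suc n)"
      by (simp add: neg del: of_nat_Suc)
    also have "\<dots> = mfps_monom (of_int c) 0"
      unfolding nat neg by (rule mfps_eqI) (simp add: mfps_nth_monom uminus_mfps_def)
    finally show ?thesis .
  qed
qed

lemma mfps_monom_prod: "(\<Prod>i\<in>A. mfps_monom (c i) (e i)) = mfps_monom (\<Prod>i\<in>A. c i) (\<Sum>i\<in>A. e i)"
  by (induction A rule: infinite_finite_induct) (simp_all add: mfps_monom_one mfps_monom_times)

lemma mfps_X_eq_monom: "mfps_X i = mfps_monom 1 (Poly_Mapping.single i 1)"
  by (simp add: mfps_X_def mfps_monom_def)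

lemma mfps_X_power: "mfps_X i ^ k = mfps_monom 1 (Poly_Mapping.single i k)"
  by (induction k) (simp_all add: mfps_monom_one mfps_X_eq_monom mfps_monom_times single_add[symmetric])

text \<open>The exponent vector of the \<open>k\<close>-th power of the monomial with exponent
  vector \<open>e\<close>.\<close>

definition multiple :: "nat \<Rightarrow> (nat \<Rightarrow>\<^sub>0 nat) \<Rightarrow> (nat \<Rightarrow>\<^sub>0 nat)" where
  "multiple k e = Poly_Mapping.map ((*) k) e"

lemma lookup_multiple: "Poly_Mapping.lookup (multiple k e) i = k * Poly_Mapping.lookup e i"
  by (simp add: multiple_def map.rep_eq when_def)

lemma multiple_0 [simp]: "multiple 0 e = 0"
  by (rule poly_mapping_eqI) (simp add: lookup_multiple)

lemma multiple_Suc: "multiple (Suc k) e = e + multiple k e"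
  by (rule poly_mapping_eqI) (simp add: lookup_multiple lookup_add)

definition exponent :: "nat list \<Rightarrow> nat \<Rightarrow>\<^sub>0 nat" where
  "exponent n = (\<Sum>i<length n. Poly_Mapping.single i (n ! i))"

lemma lookup_exponent:
  "Poly_Mapping.lookup (exponent n) i = (if i < length n then n ! i else 0)"
  by (simp add: exponent_def lookup_sum lookup_single when_def)

text \<open>A list of known length can be read off from its exponent vector, so distinct lists of
  the same length have distinct monomials. This gives the finiteness needed for sums over decreasing
  lists.\<close>

lemma map_lookup_exponent: "map (Poly_Mapping.lookup (exponent n)) [0..<length n] = n"
  by (rule nth_equalityI) (simp_all add: lookup_exponent)

lemma prod_mfps_X:
  assumes "j \<le> length n"
  shows "(\<Prod>i<j. mfps_X i ^ (n ! i)) = mfps_monom 1 (exponent (take j n))"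
  using assms by (simp add: mfps_X_power mfps_monom_prod exponent_def min_absorb2)

text \<open>At a coordinate where \<open>e\<close> is nonzero, the exponent of the
  \<open>k\<close>-th term is at least \<open>k\<close>, so only \<open>k\<close> up to that
  coordinate of \<open>m\<close> can contribute.\<close>

lemma mfps_has_sum_monom_multiples:
  assumes "e \<noteq> 0"
  shows "\<exists>S. mfps_has_sum (\<lambda>k. mfps_monom (c k) (multiple k e)) (UNIV :: nat set) S"
proof -
  obtain i where i: "Poly_Mapping.lookup e i \<noteq> 0"
    using assms by (metis poly_mapping_eqI lookup_zero)
  have "finite {k. mfps_nth (mfps_monom (c k) (multiple k e)) m \<noteq> 0}" for m
  proof (rule finite_subset)
    have "k \<le> Poly_Mapping.lookup m i" if "m = (multiple k e)" for k
      using that i by (simp add: lookup_multiple)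
    then show "{k. mfps_nth (mfps_monom (c k) (multiple k e)) m \<noteq> 0} \<subseteq> {..Poly_Mapping.lookup m i}"
      by (auto simp: mfps_nth_monom split: if_splits)
  qed simp
  then show ?thesis
    by (simp add: mfps_has_sum_def mfps_summable_on_def)
qed

text \<open>Dropping the first term has the same effect as multiplying by the monomial
  \<open>y\<close> with exponent \<open>e\<close>, so \<open>S - 1 = y * S\<close>.\<close>

lemma mfps_geometric:
  assumes "e \<noteq> 0"
  obtains S where "mfps_has_sum (\<lambda>k. mfps_monom 1 (multiple k e)) (UNIV :: nat set) S"
    and "(1 - mfps_monom 1 e) * S = 1"
proof -
  let ?y = "mfps_monom 1 e :: 'a mfps" and ?F = "\<lambda>k::nat. mfps_monom 1 (multiple k e) :: 'a mfps"
  obtain S where S: "mfps_has_sum ?F UNIV S"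
    using mfps_has_sum_monom_multiples[OF assms, of "\<lambda>_. 1"] by blast
  have "mfps_has_sum (\<lambda>k. ?F (Suc k)) UNIV (S - 1)"
    using mfps_has_sum_Suc[OF S] by (simp add: mfps_monom_one)
  moreover have "mfps_has_sum (\<lambda>k. ?F (Suc k)) UNIV (?y * S)"
    using mfps_has_sum_cmult[OF S, of ?y] by (simp add: mfps_monom_times multiple_Suc)
  ultimately have "?y * S = S - 1"
    by (rule mfps_has_sum_unique[rotated])
  with S show ?thesis
    by (intro that[of S]) (simp_all add: left_diff_distrib)
qed

text \<open>Consecutive coefficients differ by \<open>1\<close>, so multiplying the weighted series
  by \<open>1 - y\<close> gives the ordinary geometric series, and a second factor
  \<open>1 - y\<close> gives \<open>1\<close>.\<close>

lemma mfps_geometric_square: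
  assumes "e \<noteq> 0"
  obtains S where "mfps_has_sum (\<lambda>k. mfps_monom (of_nat (Suc k)) (multiple k e)) (UNIV :: nat set) S"
    and "(1 - mfps_monom 1 e)\<^sup>2 * S = 1"
proof -
  let ?y = "mfps_monom 1 e :: 'a mfps"
  let ?F = "\<lambda>k::nat. mfps_monom 1 (multiple k e) :: 'a mfps"
  let ?G = "\<lambda>k::nat. mfps_monom (of_nat (Suc k)) (multiple k e) :: 'a mfps"
  obtain S where S: "mfps_has_sum ?F UNIV S" "(1 - ?y) * S = 1"
    using mfps_geometric[OF assms] by blast
  obtain T where T: "mfps_has_sum ?G UNIV T"
    using mfps_has_sum_monom_multiples[OF assms, of "\<lambda>k. of_nat (Suc k)"] by blast
  have "mfps_has_sum (\<lambda>k. ?G (Suc k) - ?y * ?G k) UNIV ((T - 1) - ?y * T)"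
    using mfps_has_sum_diff[OF mfps_has_sum_Suc[OF T] mfps_has_sum_cmult[OF T, of ?y]]
    by (simp add: mfps_monom_one)
  moreover have "?G (Suc k) - ?y * ?G k = ?F (Suc k)" for k
    by (simp add: mfps_monom_times mfps_monom_diff multiple_Suc)
  ultimately have "mfps_has_sum (\<lambda>k. ?F (Suc k)) UNIV ((T - 1) - ?y * T)"
    by simp
  moreover have "mfps_has_sum (\<lambda>k. ?F (Suc k)) UNIV (S - 1)"
    using mfps_has_sum_Suc[OF S(1)] by (simp add: mfps_monom_one)
  ultimately have "(T - 1) - ?y * T = S - 1"
    by (rule mfps_has_sum_unique)
  then have "(1 - ?y) * T = S"
    by (simp add: left_diff_distrib algebra_simps)
  with S(2) have "(1 - ?y)\<^sup>2 * T = 1"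
    by (simp add: power2_eq_square mult.assoc)
  with T show ?thesis
    by (rule that)
qed


section \<open>Decreasing lists\<close>

lemma decreasing_lists_Cons:
  "x # xs \<in> decreasing_lists (Suc h) \<longleftrightarrow>
    1 \<le> x \<and> (\<forall>y\<in>set xs. y \<le> x) \<and> xs \<in> decreasing_lists h"
  by (auto simp: decreasing_lists_def)

lemma decreasing_lists_iff_nth:
  "n \<in> decreasing_lists h \<longleftrightarrow> length n = h \<and> (\<forall>a<h. 1 \<le> n ! a) \<and>
    (\<forall>a. Suc a < h \<longrightarrow> n ! Suc a \<le> n ! a)"
  by (auto simp: decreasing_lists_def sorted_wrt_iff_nth_Suc_transp all_set_conv_all_nth)

section \<open>Termwise factorisations into two decreasing lists\<close>

definition factor_pairs :: "nat list \<Rightarrow> (nat list \<times> nat list) set" where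
  "factor_pairs m = {(p, q). p \<in> decreasing_lists (length m) \<and> q \<in> decreasing_lists (length m) \<and>
     map2 (*) p q = m}"

lemma factor_pairs_iff:
  "m \<in> decreasing_lists h \<Longrightarrow> (p, q) \<in> factor_pairs m \<longleftrightarrow>
    p \<in> decreasing_lists h \<and> q \<in> decreasing_lists h \<and> map2 (*) p q = m"
  by (simp add: factor_pairs_def decreasing_lists_def)

lemma map2_times_decreasing:
  assumes "p \<in> decreasing_lists h" "q \<in> decreasing_lists h"
  shows "map2 (*) p q \<in> decreasing_lists h"
  using assms unfolding decreasing_lists_iff_nth
  by (auto simp: mult_le_mono Suc_le_eq)

text \<open>Entries of both factors are positive, so each is bounded by the corresponding entry of
  \<open>m\<close>, hence by \<open>sum_list m\<close>.\<close>

lemma finite_factor_pairs: "finite (factor_pairs m)"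
proof (rule finite_subset)
  let ?B = "{xs. set xs \<subseteq> {..sum_list m} \<and> length xs = length m}"
  show "finite (?B \<times> ?B)"
    by (simp add: finite_lists_length_eq)
  have "p ! a \<le> sum_list m \<and> q ! a \<le> sum_list m"
    if "(p, q) \<in> factor_pairs m" "a < length m" for p q a
  proof -
    have pq: "length p = length m" "length q = length m" "1 \<le> p ! a" "1 \<le> q ! a"
      and m: "map2 (*) p q = m"
      using that by (auto simp: factor_pairs_def decreasing_lists_iff_nth)
    have "p ! a * q ! a = m ! a"
      unfolding m[symmetric] using pq that(2) by simp
    moreover have "m ! a \<le> sum_list m"
      using that(2) by (simp add: member_le_sum_list)
    moreover have "p ! a \<le> p ! a * q ! a" "q ! a \<le> p ! a * q ! a"
      using pq by auto
    ultimately show ?thesis by linarith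
  qed
  moreover have "length p = length m \<and> length q = length m" if "(p, q) \<in> factor_pairs m" for p q
    using that by (simp add: factor_pairs_def decreasing_lists_def)
  ultimately show "factor_pairs m \<subseteq> ?B \<times> ?B"
    by (auto simp: in_set_conv_nth)
qed

section \<open>Decreasing lists in terms of their gaps\<close>

text \<open>
  The partition with successive differences \<open>ks\<close>, the last part being compared with \<open>1\<close>.
\<close>

fun parts_of_gaps :: "nat list \<Rightarrow> nat list" where
  "parts_of_gaps [] = []"
| "parts_of_gaps (k # ks) = Suc (k + sum_list ks) # parts_of_gaps ks"

lemma length_parts_of_gaps [simp]: "length (parts_of_gaps ks) = length ks"
  by (induction ks) auto

lemma nth_parts_of_gaps:
  "i < length ks \<Longrightarrow> parts_of_gaps ks ! i = Suc (sum_list (drop i ks))"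
  by (induction ks arbitrary: i) (auto simp: nth_Cons split: nat.split)

lemma parts_of_gaps_le: "x \<in> set (parts_of_gaps ks) \<Longrightarrow> x \<le> Suc (sum_list ks)"
  by (induction ks) auto

lemma bij_betw_parts_of_gaps:
  "bij_betw parts_of_gaps {ks. length ks = h} (decreasing_lists h)"
proof -
  have "ks = ls" if "parts_of_gaps ks = parts_of_gaps ls" for ks ls
    using that
  proof (induction ks arbitrary: ls)
    case Nil
    then show ?case by (cases ls) auto
  next
    case (Cons k ks)
    then show ?case by (cases ls) auto
  qed
  then have "inj_on parts_of_gaps {ks. length ks = h}"
    by (auto simp: inj_on_def)
  moreover have "parts_of_gaps ks \<in> decreasing_lists (length ks)" for ks
  proof (induction ks)
    case (Cons k ks)
    then show ?case
      by (auto simp: decreasing_lists_Cons dest: parts_of_gaps_le)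
  qed (simp add: decreasing_lists_def)
  moreover have "\<exists>ks. length ks = h \<and> parts_of_gaps ks = n" if "n \<in> decreasing_lists h" for n
    using that
  proof (induction n arbitrary: h)
    case Nil
    then show ?case by (auto simp: decreasing_lists_def)
  next
    case (Cons x xs)
    then obtain h' where h: "h = Suc h'"
      by (cases h) (auto simp: decreasing_lists_def)
    with Cons obtain ks where ks: "length ks = h'" "parts_of_gaps ks = xs"
      by (auto simp: decreasing_lists_Cons)
    \<comment> \<open>\<open>Suc (sum_list ks)\<close> is the first part of \<open>xs\<close>, or
      \<open>1\<close> when \<open>xs\<close> is empty; the new gap is its difference from
      \<open>x\<close>.\<close>
    have "Suc (sum_list ks) \<le> x"
      using Cons.prems ks unfolding h decreasing_lists_Cons by (cases ks) auto
    then show ?case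
      using h ks by (intro exI[of _ "(x - Suc (sum_list ks)) # ks"]) auto
  qed
  ultimately show ?thesis
    by (force simp: bij_betw_def)
qed

text \<open>The last entry of \<open>ks\<close> measures the distance of the last part from
  \<open>1\<close>, which has no factor in \<open>gap_product\<close>; hence the bound
  \<open>length ks - 1\<close>.\<close>

lemma gap_product_parts_of_gaps:
  "gap_product (parts_of_gaps ks) = (\<Prod>j<length ks - 1. int (Suc (ks ! j)))"
  unfolding gap_product_def
proof (intro prod.cong)
  fix j assume "j \<in> {..<length ks - 1}"
  then show "int (parts_of_gaps ks ! j) - int (parts_of_gaps ks ! Suc j) + 1 = int (Suc (ks ! j))"
    by (simp add: nth_parts_of_gaps Cons_nth_drop_Suc[symmetric])
qed simp

text \<open>The \<open>i\<close>-th part is one plus the sum of the gaps \<open>ks ! j\<close> with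
  \<open>i \<le> j\<close>. After multiplication by \<open>n ! i\<close>, the gap \<open>j\<close>
  therefore accounts for \<open>ks ! j\<close> copies of the prefix
  \<open>take (Suc j) n\<close>.\<close>

lemma exponent_map2_parts_of_gaps:
  assumes "length n = length ks"
  shows "exponent (map2 (*) n (parts_of_gaps ks))
    = exponent n + (\<Sum>j<length ks. multiple (ks ! j) (exponent (take (Suc j) n)))"
proof (rule poly_mapping_eqI)
  fix i
  have "n ! i * Suc (sum_list (drop i ks)) =
      n ! i + (\<Sum>j<length ks. ks ! j * (if i \<le> j then n ! i else 0))" if "i < length ks"
  proof -
    have "sum_list (drop i ks) = (\<Sum>j = i..<length ks. ks ! j)"
      using that sum.shift_bounds_nat_ivl[of "(!) ks" 0 i "length ks - i"]
      by (simp add: sum_list_sum_nth add.commute)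
    also have "\<dots> = (\<Sum>j | j < length ks \<and> i \<le> j. ks ! j)"
      by (rule sum.cong) auto
    also have "n ! i * \<dots> = (\<Sum>j<length ks. ks ! j * (if i \<le> j then n ! i else 0))"
      unfolding sum_distrib_left by (rule sum.mono_neutral_cong_left) auto
    finally show ?thesis by simp
  qed
  then show "Poly_Mapping.lookup (exponent (map2 (*) n (parts_of_gaps ks))) i =
      Poly_Mapping.lookup
        (exponent n + (\<Sum>j<length ks. multiple (ks ! j) (exponent (take (Suc j) n)))) i"
    using assms
    by (auto simp: lookup_exponent lookup_add lookup_sum lookup_multiple nth_parts_of_gaps intro!: sum.cong)
qed


section \<open>Counting espaliers and pyramids\<close>

lemma layer_eq_iff:
  assumes "1 \<le> p" "1 \<le> q" "1 \<le> p'" "1 \<le> q'"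
  shows "layer b c p q = layer b' c' p' q' \<longleftrightarrow> b = b' \<and> c = c' \<and> p = p' \<and> q = q'"
  using assms by (auto simp: layer_def times_eq_iff atLeastLessThan_eq_iff)

text \<open>Nonemptiness lets the inclusion of rectangles split into two independent inclusions of
  intervals; this is why the number of pyramids with given sides is a product of a factor for
  \<open>p\<close> and one for \<open>q\<close>.\<close>

lemma layer_subset_iff:
  assumes "1 \<le> p" "1 \<le> q"
  shows "layer b c p q \<subseteq> layer b' c' p' q' \<longleftrightarrow>
    (b' \<le> b \<and> b + int p \<le> b' + int p') \<and> (c' \<le> c \<and> c + int q \<le> c' + int q')"
proof -
  have "b \<in> {b..<b + int p}" "c \<in> {c..<c + int q}"
    using assms by auto
  then have "layer b c p q \<subseteq> layer b' c' p' q' \<longleftrightarrow>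
      {b..<b + int p} \<subseteq> {b'..<b' + int p'} \<and> {c..<c + int q} \<subseteq> {c'..<c' + int q'}"
    unfolding layer_def by blast
  then show ?thesis
    using assms by (simp add: atLeastLessThan_subset_iff)
qed

text \<open>A layer is the section of the stack at its level, and a nonempty rectangle determines
  its corner and side lengths. This makes the parametrisations below injective.\<close>

lemma stack_eqD:
  assumes eq: "stack h b c p q = stack h b' c' p' q'"
    and pos: "\<forall>a<h. 1 \<le> p a \<and> 1 \<le> q a" "\<forall>a<h. 1 \<le> p' a \<and> 1 \<le> q' a"
    and "a < h"
  shows "b a = b' a \<and> c a = c' a \<and> p a = p' a \<and> q a = q' a"
proof -
  have "layer (b a) (c a) (p a) (q a) = {y. (int a, y) \<in> stack h b c p q}" for b c p q
    using \<open>a < h\<close> by (auto simp: stack_def)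
  then have "layer (b a) (c a) (p a) (q a) = layer (b' a) (c' a) (p' a) (q' a)"
    using eq by metis
  then show ?thesis
    using pos \<open>a < h\<close> by (simp add: layer_eq_iff)
qed

lemma stack_cong:
  "(\<And>a. a < h \<Longrightarrow> b a = b' a \<and> c a = c' a \<and> p a = p' a \<and> q a = q' a) \<Longrightarrow>
    stack h b c p q = stack h b' c' p' q'"
  by (auto simp: stack_def)

lemma card_plateau_stack_iff:
  assumes "length p = length m" "length q = length m"
  shows "(\<forall>a<length m. card (plateau a (stack (length m) b c ((!) p) ((!) q))) = m ! a) \<longleftrightarrow>
    map2 (*) p q = m"
  using assms by (auto simp: card_plateau list_eq_iff_nth_eq)

lemma espalier_count_eq: "espalier_count m = card (factor_pairs m)"
proof -
  let ?h = "length m"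
  let ?s = "\<lambda>(p, q). stack ?h (\<lambda>_. 0) (\<lambda>_. 0) ((!) p) ((!) q)"
  have inj: "inj_on ?s (factor_pairs m)"
  proof (rule inj_onI, clarify)
    fix p q p' q'
    assume pq: "(p, q) \<in> factor_pairs m" "(p', q') \<in> factor_pairs m"
      and eq: "stack ?h (\<lambda>_. 0) (\<lambda>_. 0) ((!) p) ((!) q) = stack ?h (\<lambda>_. 0) (\<lambda>_. 0) ((!) p') ((!) q')"
    have "p ! a = p' ! a \<and> q ! a = q' ! a" if "a < ?h" for a
      using stack_eqD[OF eq _ _ that] pq by (auto simp: factor_pairs_def decreasing_lists_iff_nth)
    then show "p = p' \<and> q = q'"
      using pq by (auto simp: factor_pairs_def decreasing_lists_iff_nth list_eq_iff_nth_eq)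
  qed
  have image: "?s ` factor_pairs m = {S \<in> espaliers ?h. \<forall>a<?h. card (plateau a S) = m ! a}"
  proof (intro equalityI subsetI)
    fix S assume "S \<in> ?s ` factor_pairs m"
    then obtain p q where pq: "(p, q) \<in> factor_pairs m"
      and S: "S = stack ?h (\<lambda>_. 0) (\<lambda>_. 0) ((!) p) ((!) q)"
      by auto
    have "p ! a \<le> p ! (a - 1) \<and> q ! a \<le> q ! (a - 1)" if "1 \<le> a" "a < ?h" for a
      using pq that by (cases a) (auto simp: factor_pairs_def decreasing_lists_iff_nth)
    moreover have "\<forall>a<?h. 1 \<le> p ! a \<and> 1 \<le> q ! a"
      using pq by (auto simp: factor_pairs_def decreasing_lists_iff_nth)
    ultimately have "S \<in> espaliers ?h"
      unfolding espaliers_def S by blast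
    then show "S \<in> {S \<in> espaliers ?h. \<forall>a<?h. card (plateau a S) = m ! a}"
      using pq unfolding S
      by (auto simp: card_plateau_stack_iff factor_pairs_def decreasing_lists_def)
  next
    fix S assume "S \<in> {S \<in> espaliers ?h. \<forall>a<?h. card (plateau a S) = m ! a}"
    then obtain p q where S: "S = stack ?h (\<lambda>_. 0) (\<lambda>_. 0) p q" "\<forall>a<?h. 1 \<le> p a \<and> 1 \<le> q a"
      and dec: "\<forall>a. 1 \<le> a \<and> a < ?h \<longrightarrow> p a \<le> p (a - 1) \<and> q a \<le> q (a - 1)"
      and card: "\<forall>a<?h. card (plateau a S) = m ! a"
      by (auto simp: espaliers_def)
    \<comment> \<open>A stack depends on its parameter functions only below the height; restricting
      them to lists of length \<open>?h\<close> gives a unique representative.\<close>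
    let ?p = "map p [0..<?h]" and ?q = "map q [0..<?h]"
    have S': "S = ?s (?p, ?q)"
      unfolding S(1) by (simp, intro stack_cong) auto
    have "?p \<in> decreasing_lists ?h" "?q \<in> decreasing_lists ?h"
      using S(2) dec by (auto simp: decreasing_lists_iff_nth dest: spec[of _ "Suc _"])
    moreover have "map2 (*) ?p ?q = m"
      using card unfolding S' by (subst card_plateau_stack_iff[symmetric]) auto
    ultimately show "S \<in> ?s ` factor_pairs m"
      using S' by (auto simp: factor_pairs_def)
  qed
  show ?thesis
    unfolding espalier_count_def image[symmetric] by (rule card_image[OF inj])
qed

text \<open>The positions, in one coordinate, of nested intervals with the given lengths, the
  outermost starting at \<open>t\<close>. The shift \<open>d\<close> stops at \<open>x - y\<close>
  because the next interval must end inside the current one.\<close>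

fun offsets :: "int \<Rightarrow> nat list \<Rightarrow> int list set" where
  "offsets t [] = {[]}"
| "offsets t [x] = {[t]}"
| "offsets t (x # y # xs) = (\<Union>d\<in>{0..int x - int y}. (#) t ` offsets (t + d) (y # xs))"

lemma finite_offsets: "finite (offsets t p)"
  by (induction t p rule: offsets.induct) auto

text \<open>An interval of length \<open>y\<close> fits into one of length \<open>x\<close> in
  \<open>x - y + 1\<close> ways, and the number of continuations does not depend on the starting
  point.\<close>

lemma card_offsets:
  "p \<in> decreasing_lists h \<Longrightarrow> int (card (offsets t p)) = gap_product p"
proof (induction t p arbitrary: h rule: offsets.induct)
  case (3 t x y xs)
  then obtain h' where h: "h = Suc h'"
    by (cases h) (auto simp: decreasing_lists_def)
  have yx: "y \<le> x" and dec: "y # xs \<in> decreasing_lists h'"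
    using 3(2) unfolding h decreasing_lists_Cons by auto
  \<comment> \<open>For disjointness of the union: lists from different \<open>d\<close> differ in
    their second entry \<open>t + d\<close>.\<close>
  have start: "b \<noteq> [] \<and> hd b = s" if "b \<in> offsets s (z # zs)" for b s z zs
    using that by (cases zs) auto
  have "card (offsets t (x # y # xs))
      = (\<Sum>d\<in>{0..int x - int y}. card ((#) t ` offsets (t + d) (y # xs)))"
    unfolding offsets.simps
    by (rule card_UN_disjoint) (auto simp: finite_offsets dest!: start)
  also have "int \<dots> = (\<Sum>d\<in>{0..int x - int y}. gap_product (y # xs))"
    using 3(1)[OF _ dec] by (simp add: card_image)
  also have "\<dots> = gap_product (x # y # xs)"
    using yx by (simp add: gap_product_def prod.lessThan_Suc_shift del: prod.lessThan_Suc)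
  finally show ?case .
qed (auto simp: gap_product_def)

text \<open>The recursion serves the count; this pointwise form matches the nesting condition for
  layers, one coordinate at a time.\<close>

lemma offsets_iff:
  "b \<in> offsets t p \<longleftrightarrow> length b = length p \<and> (p \<noteq> [] \<longrightarrow> b ! 0 = t) \<and>
    (\<forall>a. Suc a < length p \<longrightarrow>
      b ! a \<le> b ! Suc a \<and> b ! Suc a + int (p ! Suc a) \<le> b ! a + int (p ! a))"
proof (induction t p arbitrary: b rule: offsets.induct)
  case (2 t x)
  then show ?case by (auto simp: length_Suc_conv)
next
  case (3 t x y xs)
  show ?case (is "?L \<longleftrightarrow> ?R")
  proof
    assume ?L
    then obtain d b' where b: "b = t # b'" "0 \<le> d" "d \<le> int x - int y" "b' \<in> offsets (t + d) (y # xs)"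
      by auto
    with 3[of d b'] show ?R
      by (auto simp: nth_Cons split: nat.split)
  next
    assume R: ?R
    then obtain b' where b: "b = t # b'"
      by (cases b) auto
    let ?d = "b' ! 0 - t"
    have all: "b ! a \<le> b ! Suc a \<and> b ! Suc a + int ((x # y # xs) ! Suc a)
        \<le> b ! a + int ((x # y # xs) ! a)" if "Suc a < length (x # y # xs)" for a
      using R that by blast
    from all[of 0] have d: "?d \<in> {0..int x - int y}"
      by (simp add: b)
    have "b' \<in> offsets (t + ?d) (y # xs)"
      unfolding 3[OF d] using R all[of "Suc a" for a] by (auto simp: b)
    then have "b \<in> (#) t ` offsets (t + ?d) (y # xs)"
      by (auto simp: b)
    with d show ?L
      unfolding offsets.simps by blast
  qed
qed auto

text \<open>A pyramid is a factor pair with independent offsets in the two coordinates, so the fibre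
  over \<open>(p, q)\<close> is \<open>offsets 0 p \<times> offsets 0 q\<close>.\<close>

lemma pyramid_count_eq:
  assumes "m \<noteq> []"
  shows "int (pyramid_count m) = (\<Sum>(p, q)\<in>factor_pairs m. gap_product p * gap_product q)"
proof -
  let ?h = "length m"
  let ?X = "SIGMA (p, q):factor_pairs m. offsets 0 p \<times> offsets 0 q"
  let ?s = "\<lambda>((p, q), (b, c)). stack ?h ((!) b) ((!) c) ((!) p) ((!) q)"
  have h: "0 < ?h" using assms by simp
  have inj: "inj_on ?s ?X"
  proof (rule inj_onI)
    fix x y assume xy: "x \<in> ?X" "y \<in> ?X" "?s x = ?s y"
    obtain p q b c where x: "x = ((p, q), (b, c))"
      by (metis surj_pair)
    obtain p' q' b' c' where y: "y = ((p', q'), (b', c'))"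
      by (metis surj_pair)
    have pq: "(p, q) \<in> factor_pairs m" "(p', q') \<in> factor_pairs m"
      and bc: "b \<in> offsets 0 p" "c \<in> offsets 0 q" "b' \<in> offsets 0 p'" "c' \<in> offsets 0 q'"
      and eq: "stack ?h ((!) b) ((!) c) ((!) p) ((!) q) = stack ?h ((!) b') ((!) c') ((!) p') ((!) q')"
      using xy unfolding x y by auto
    have "b ! a = b' ! a \<and> c ! a = c' ! a \<and> p ! a = p' ! a \<and> q ! a = q' ! a" if "a < ?h" for a
      using stack_eqD[OF eq _ _ that] pq by (auto simp: factor_pairs_def decreasing_lists_iff_nth)
    moreover have "length p = ?h" "length q = ?h" "length p' = ?h" "length q' = ?h"
      using pq by (auto simp: factor_pairs_def decreasing_lists_def)
    moreover from this have "length b = ?h" "length c = ?h" "length b' = ?h" "length c' = ?h"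
      using bc by (simp_all add: offsets_iff)
    ultimately show "x = y"
      unfolding x y by (simp add: list_eq_iff_nth_eq)
  qed
  have image: "?s ` ?X = {S \<in> pyramids ?h. \<forall>a<?h. card (plateau a S) = m ! a}"
  proof (intro equalityI subsetI)
    fix S assume "S \<in> ?s ` ?X"
    then obtain p q b c where pq: "(p, q) \<in> factor_pairs m"
      and bc: "b \<in> offsets 0 p" "c \<in> offsets 0 q"
      and S: "S = stack ?h ((!) b) ((!) c) ((!) p) ((!) q)"
      by auto
    have len: "length p = ?h" "length q = ?h" and pos: "\<forall>a<?h. 1 \<le> p ! a \<and> 1 \<le> q ! a"
      using pq by (auto simp: factor_pairs_def decreasing_lists_iff_nth)
    have "layer (b ! a) (c ! a) (p ! a) (q ! a)
        \<subseteq> layer (b ! (a - 1)) (c ! (a - 1)) (p ! (a - 1)) (q ! (a - 1))"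
      if "1 \<le> a" "a < ?h" for a
    proof -
      obtain a' where "a = Suc a'" using \<open>1 \<le> a\<close> by (cases a) auto
      then show ?thesis
        using bc len pos that by (simp add: layer_subset_iff offsets_iff)
    qed
    moreover have "b ! 0 = 0" "c ! 0 = 0"
      using bc len h by (auto simp: offsets_iff)
    ultimately have "S \<in> pyramids ?h"
      unfolding pyramids_def S using pos by blast
    then show "S \<in> {S \<in> pyramids ?h. \<forall>a<?h. card (plateau a S) = m ! a}"
      using pq len unfolding S by (auto simp: card_plateau_stack_iff factor_pairs_def)
  next
    fix S assume "S \<in> {S \<in> pyramids ?h. \<forall>a<?h. card (plateau a S) = m ! a}"
    then obtain b c p q where S: "S = stack ?h b c p q" "b 0 = 0" "c 0 = 0"
      and pos: "\<forall>a<?h. 1 \<le> p a \<and> 1 \<le> q a"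
      and sub: "\<forall>a. 1 \<le> a \<and> a < ?h \<longrightarrow>
        layer (b a) (c a) (p a) (q a) \<subseteq> layer (b (a - 1)) (c (a - 1)) (p (a - 1)) (q (a - 1))"
      and card: "\<forall>a<?h. card (plateau a S) = m ! a"
      by (auto simp: pyramids_def)
    let ?b = "map b [0..<?h]" and ?c = "map c [0..<?h]"
    let ?p = "map p [0..<?h]" and ?q = "map q [0..<?h]"
    have S': "S = ?s ((?p, ?q), (?b, ?c))"
      unfolding S(1) by (simp, intro stack_cong) auto
    have step: "(b a \<le> b (Suc a) \<and> b (Suc a) + int (p (Suc a)) \<le> b a + int (p a)) \<and>
        (c a \<le> c (Suc a) \<and> c (Suc a) + int (q (Suc a)) \<le> c a + int (q a))"
      if "Suc a < ?h" for a
      using sub[rule_format, of "Suc a"] pos that by (simp add: layer_subset_iff)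
    have "?b \<in> offsets 0 ?p" "?c \<in> offsets 0 ?q"
      using S step h by (auto simp: offsets_iff)
    \<comment> \<open>The side lengths decrease because, in each coordinate, the two inequalities of
      \<open>step\<close> add up to \<open>p (Suc a) \<le> p a\<close> and
      \<open>q (Suc a) \<le> q a\<close>.\<close>
    moreover have "?p \<in> decreasing_lists ?h" "?q \<in> decreasing_lists ?h"
      using pos step by (force simp: decreasing_lists_iff_nth)+
    moreover have "map2 (*) ?p ?q = m"
      using card unfolding S' by (subst card_plateau_stack_iff[symmetric]) auto
    ultimately have "((?p, ?q), (?b, ?c)) \<in> ?X"
      by (auto simp: factor_pairs_def)
    then show "S \<in> ?s ` ?X"
      unfolding S' by (rule imageI)
  qed
  have "pyramid_count m = card ?X"
    unfolding pyramid_count_def image[symmetric] by (rule card_image[OF inj])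
  also have "\<dots> = (\<Sum>(p, q)\<in>factor_pairs m. card (offsets 0 p) * card (offsets 0 q))"
    by (subst card_SigmaI)
       (auto simp: finite_factor_pairs finite_offsets card_cartesian_product intro!: sum.cong)
  also have "int \<dots> = (\<Sum>(p, q)\<in>factor_pairs m. gap_product p * gap_product q)"
    by (auto simp: factor_pairs_def card_offsets intro!: sum.cong)
  finally show ?thesis .
qed


section \<open>Dirichlet series\<close>

definition mds_monom :: "'a::comm_ring_1 \<Rightarrow> dirichlet_index \<Rightarrow> 'a mds" where
  "mds_monom c e = Abs_mds (\<lambda>m. if m = e then c else 0)"

lemma mds_nth_monom: "mds_nth (mds_monom c e) m = (if m = e then c else 0)"
  by (simp add: mds_monom_def)

lemma mds_monom_times: "mds_monom c e * mds_monom d f = mds_monom (c * d) (e * f)"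
  by (rule mds_eqI) (simp add: times_mds_def mds_nth_monom mds.conv_monom)

lemma mds_monom_prod: "(\<Prod>i\<in>A. mds_monom (c i) (e i)) = mds_monom (\<Prod>i\<in>A. c i) (\<Prod>i\<in>A. e i)"
proof -
  have "mds_monom (1::'a) 1 = 1"
    by (simp add: mds_monom_def one_mds_def)
  then show ?thesis
    by (induction A rule: infinite_finite_induct) (simp_all add: mds_monom_times)
qed

lemma of_int_mds: "(of_int c :: 'a::comm_ring_1 mds) = mds_monom (of_int c) 1"
proof -
  have nat: "(of_nat n :: 'a mds) = mds_monom (of_nat n) 1" for n
    by (induction n) (auto intro!: mds_eqI simp: mds_nth_monom zero_mds_def plus_mds_def one_mds_def)
  show ?thesis
  proof (cases c)
    case (nonneg n)
    then show ?thesis by (simp add: nat)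
  next
    case (neg n)
    have "(of_int c :: 'a mds) = - of_nat (Suc n)"
      by (simp add: neg del: of_nat_Suc)
    also have "\<dots> = mds_monom (of_int c) 1"
      unfolding nat neg by (rule mds_eqI) (simp add: mds_nth_monom uminus_mds_def)
    finally show ?thesis .
  qed
qed

lemma mds_infsum_cong:
  assumes "\<And>i. i \<in> I \<Longrightarrow> F i = G i"
  shows "mds_infsum F I = mds_infsum G I"
  unfolding mds_infsum_def using assms by (intro arg_cong[of _ _ Abs_mds] ext sum.cong) auto

definition dirichlet_single :: "nat \<Rightarrow> nat \<Rightarrow> dirichlet_index" where
  "dirichlet_single i a = Abs_dirichlet_index (\<lambda>j. if j = i then a else 1)"

lemma base_dirichlet_single:
  "0 < a \<Longrightarrow> base (dirichlet_single i a) = (\<lambda>j. if j = i then a else 1)"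
  unfolding dirichlet_single_def
  by (subst Abs_dirichlet_index_inverse) (auto intro: finite_subset[of _ "{i}"])

lemma mds_pow_eq_monom: "0 < a \<Longrightarrow> mds_pow i a = mds_monom 1 (dirichlet_single i a)"
  by (simp add: mds_pow_def mds_monom_def base_dirichlet_single[symmetric] base_inject)

lemma base_prod: "base (\<Prod>i\<in>A. e i) j = (\<Prod>i\<in>A. base (e i) j)"
  by (induction A rule: infinite_finite_induct) auto

definition dirichlet_exponent :: "nat list \<Rightarrow> dirichlet_index" where
  "dirichlet_exponent n = (\<Prod>i<length n. dirichlet_single i (n ! i))"

lemma base_dirichlet_exponent:
  assumes "n \<in> decreasing_lists h"
  shows "base (dirichlet_exponent n) j = (if j < h then n ! j else 1)"
proof -
  have "base (dirichlet_exponent n) j = (\<Prod>i<h. if j = i then n ! i else 1)"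
    using assms unfolding dirichlet_exponent_def base_prod
    by (intro prod.cong) (auto simp: decreasing_lists_iff_nth base_dirichlet_single Suc_le_eq)
  then show ?thesis
    by simp
qed

lemma inj_on_dirichlet_exponent: "inj_on dirichlet_exponent (decreasing_lists h)"
proof (rule inj_onI)
  fix m n assume mn: "m \<in> decreasing_lists h" "n \<in> decreasing_lists h"
    "dirichlet_exponent m = dirichlet_exponent n"
  have "m ! j = n ! j" if "j < h" for j
    using base_dirichlet_exponent[OF mn(1), of j] base_dirichlet_exponent[OF mn(2), of j] mn(3) that
    by simp
  then show "m = n"
    using mn by (auto simp: decreasing_lists_def list_eq_iff_nth_eq)
qed

text \<open>Termwise multiplication of lists becomes multiplication of Dirichlet indices; this is
  why squares of Dirichlet series sum over factor pairs.\<close>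

lemma dirichlet_exponent_map2:
  assumes "p \<in> decreasing_lists h" "q \<in> decreasing_lists h"
  shows "dirichlet_exponent (map2 (*) p q) = dirichlet_exponent p * dirichlet_exponent q"
proof (rule dirichlet_index_eqI)
  fix j
  have "length p = h" "length q = h"
    using assms by (auto simp: decreasing_lists_def)
  then show "base (dirichlet_exponent (map2 (*) p q)) j
      = base (dirichlet_exponent p * dirichlet_exponent q) j"
    by (simp add: base_dirichlet_exponent[OF assms(1)] base_dirichlet_exponent[OF assms(2)]
        base_dirichlet_exponent[OF map2_times_decreasing[OF assms]])
qed

text \<open>An arbitrary weight covers the counting series and the multiple zeta series alike, with
  \<open>w\<close> a count, \<open>1\<close> or \<open>gap_product\<close>.\<close>

definition dirichlet_sum :: "(nat list \<Rightarrow> int) \<Rightarrow> nat \<Rightarrow> int mds" where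
  "dirichlet_sum w h =
    mds_infsum (\<lambda>n. of_int (w n) * (\<Prod>i<h. mds_pow i (n ! i))) (decreasing_lists h)"

lemma dirichlet_sum_term:
  assumes "n \<in> decreasing_lists h"
  shows "of_int (w n) * (\<Prod>i<h. mds_pow i (n ! i)) = mds_monom (w n) (dirichlet_exponent n)"
proof -
  have "(\<Prod>i<h. mds_pow i (n ! i)) = (\<Prod>i<h. mds_monom (1::int) (dirichlet_single i (n ! i)))"
    using assms by (intro prod.cong) (auto simp: decreasing_lists_iff_nth mds_pow_eq_monom Suc_le_eq)
  then show ?thesis
    using assms
    by (simp add: of_int_mds mds_monom_prod mds_monom_times dirichlet_exponent_def decreasing_lists_def)
qed

text \<open>By injectivity of \<open>dirichlet_exponent\<close> on decreasing lists, at most one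
  list has index \<open>r\<close>, so the sum is finite.\<close>

lemma mds_nth_dirichlet_sum:
  "mds_nth (dirichlet_sum w h) r = (\<Sum>n | n \<in> decreasing_lists h \<and> dirichlet_exponent n = r. w n)"
proof -
  have fin: "finite {n. n \<in> decreasing_lists h \<and> dirichlet_exponent n = r}"
  proof (cases "\<exists>n \<in> decreasing_lists h. dirichlet_exponent n = r")
    case True
    then obtain n where "n \<in> decreasing_lists h" "dirichlet_exponent n = r" by blast
    then have "{n. n \<in> decreasing_lists h \<and> dirichlet_exponent n = r} = {n}"
      using inj_on_dirichlet_exponent[of h] by (auto simp: inj_on_def)
    then show ?thesis by simp
  next
    case False
    then have "{n. n \<in> decreasing_lists h \<and> dirichlet_exponent n = r} = {}" by blast
    then show ?thesis by (metis finite.emptyI)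
  qed
  let ?F = "\<lambda>n. of_int (w n) * (\<Prod>i<h. mds_pow i (n ! i)) :: int mds"
  have nth: "mds_nth (?F n) r = (if dirichlet_exponent n = r then w n else 0)"
    if "n \<in> decreasing_lists h" for n
    using that by (auto simp: dirichlet_sum_term mds_nth_monom)
  have "mds_nth (dirichlet_sum w h) r
      = (\<Sum>n | n \<in> decreasing_lists h \<and> mds_nth (?F n) r \<noteq> 0. mds_nth (?F n) r)"
    by (simp add: dirichlet_sum_def mds_infsum_def)
  also have "\<dots> = (\<Sum>n | n \<in> decreasing_lists h \<and> dirichlet_exponent n = r. w n)"
  proof (rule sum.mono_neutral_cong_left[OF fin])
    show "\<forall>n\<in>{n. n \<in> decreasing_lists h \<and> dirichlet_exponent n = r} -
        {n. n \<in> decreasing_lists h \<and> mds_nth (?F n) r \<noteq> 0}. w n = 0"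
      using nth by fastforce
  qed (use nth in \<open>auto split: if_splits\<close>)
  finally show ?thesis .
qed

text \<open>At index \<open>r\<close> both sides sum \<open>w p * w q\<close> over the pairs in
  \<open>?P\<close>: the square groups them by the indices of \<open>p\<close> and \<open>q\<close>,
  the left-hand side by their termwise product \<open>m\<close>.\<close>

lemma dirichlet_sum_square:
  "dirichlet_sum (\<lambda>m. \<Sum>(p, q)\<in>factor_pairs m. w p * w q) h = (dirichlet_sum w h)\<^sup>2"
proof (rule mds_eqI)
  fix r
  let ?D = "decreasing_lists h" and ?e = dirichlet_exponent
  let ?N = "\<lambda>k. {n. n \<in> ?D \<and> ?e n = k}"
  have subsingleton: "?N k = {} \<or> (\<exists>n. ?N k = {n})" for k
    using inj_on_dirichlet_exponent[of h] by (fastforce simp: inj_on_def)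
  then have fin: "finite (?N k)" for k
    by (metis finite.emptyI finite.insertI)
  let ?P = "{(p, q). p \<in> ?D \<and> q \<in> ?D \<and> ?e p * ?e q = r}"
  have "mds_nth ((dirichlet_sum w h)\<^sup>2) r
      = (\<Sum>x | fst x * snd x = r. \<Sum>y\<in>?N (fst x) \<times> ?N (snd x). w (fst y) * w (snd y))"
    by (simp add: power2_eq_square times_mds_def mds_nth_dirichlet_sum sum_product
        sum.cartesian_product case_prod_unfold)
  also have "\<dots> = (\<Sum>(x, y)\<in>(SIGMA x:{x. fst x * snd x = r}. ?N (fst x) \<times> ?N (snd x)).
      w (fst y) * w (snd y))"
    by (rule sum.Sigma) (use mds.finite_factors[of r] fin in \<open>auto simp: case_prod_unfold\<close>)
  also have "\<dots> = (\<Sum>(p, q)\<in>?P. w p * w q)"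
    by (rule sum.reindex_bij_witness[where j = snd and i = "\<lambda>(p, q). ((?e p, ?e q), (p, q))"]) auto
  also have "\<dots> = (\<Sum>(m, x)\<in>Sigma (?N r) factor_pairs. w (fst x) * w (snd x))"
    by (rule sum.reindex_bij_witness[where i = snd and j = "\<lambda>(p, q). (map2 (*) p q, (p, q))"])
       (auto simp: factor_pairs_iff[where h = h] dirichlet_exponent_map2 map2_times_decreasing)
  also have "\<dots> = (\<Sum>m\<in>?N r. \<Sum>x\<in>factor_pairs m. w (fst x) * w (snd x))"
    by (rule sum.Sigma[symmetric]) (use fin finite_factor_pairs in auto)
  also have "\<dots> = mds_nth (dirichlet_sum (\<lambda>m. \<Sum>(p, q)\<in>factor_pairs m. w p * w q) h) r"
    by (simp add: mds_nth_dirichlet_sum case_prod_unfold)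
  finally show "mds_nth (dirichlet_sum (\<lambda>m. \<Sum>(p, q)\<in>factor_pairs m. w p * w q) h) r
      = mds_nth ((dirichlet_sum w h)\<^sup>2) r" ..
qed


section \<open>Power series\<close>

lemma mfps_has_sum_decreasing_lists:
  "mfps_has_sum (\<lambda>m. mfps_monom (w m) (exponent m)) (decreasing_lists h)
    (mfps_infsum (\<lambda>m. of_int (w m) * (\<Prod>i<h. mfps_X i ^ (m ! i))) (decreasing_lists h))"
proof -
  have eq: "of_int (w m) * (\<Prod>i<h. mfps_X i ^ (m ! i)) = mfps_monom (w m) (exponent m)"
    if "m \<in> decreasing_lists h" for m
    using that by (simp add: prod_mfps_X of_int_mfps mfps_monom_times decreasing_lists_def)
  have "finite {m \<in> decreasing_lists h. mfps_nth (mfps_monom (w m) (exponent m)) r \<noteq> 0}" for r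
  proof (rule finite_subset)
    have "m = map (Poly_Mapping.lookup r) [0..<h]"
      if "m \<in> decreasing_lists h" "r = exponent m" for m
      using that map_lookup_exponent[of m] by (simp add: decreasing_lists_def)
    then show "{m \<in> decreasing_lists h. mfps_nth (mfps_monom (w m) (exponent m)) r \<noteq> 0}
        \<subseteq> {map (Poly_Mapping.lookup r) [0..<h]}"
      by (auto simp: mfps_nth_monom split: if_splits)
  qed simp
  then show ?thesis
    using mfps_infsum_cong[OF eq] by (simp add: mfps_has_sum_def mfps_summable_on_def)
qed

text \<open>The exponent vector determines the termwise product of \<open>p\<close> and
  \<open>q\<close>, which has finitely many factor pairs; hence the double family is summable.
  Grouping by the product identifies its sum with \<open>S\<close>.\<close>

lemma mfps_has_sum_pairs:
  fixes w :: "nat list \<Rightarrow> int" and h :: nat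
  defines "S \<equiv> mfps_infsum (\<lambda>m. of_int (\<Sum>(p, q)\<in>factor_pairs m. w p * w q) *
      (\<Prod>i<h. mfps_X i ^ (m ! i))) (decreasing_lists h)"
  shows "mfps_has_sum (\<lambda>(p, q). mfps_monom (w p * w q) (exponent (map2 (*) p q)))
    (decreasing_lists h \<times> decreasing_lists h) S"
proof -
  let ?D = "decreasing_lists h"
  let ?F = "\<lambda>(p, q). mfps_monom (w p * w q) (exponent (map2 (*) p q))"
  have bij: "bij_betw snd (Sigma ?D factor_pairs) (?D \<times> ?D)"
    by (rule bij_betw_byWitness[where f' = "\<lambda>(p, q). (map2 (*) p q, (p, q))"])
       (auto simp: factor_pairs_iff[where h = h] map2_times_decreasing)
  have "finite {x \<in> ?D \<times> ?D. mfps_nth (?F x) r \<noteq> 0}" for r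
  proof (rule finite_subset)
    have "(p, q) \<in> factor_pairs (map (Poly_Mapping.lookup r) [0..<h])"
      if "p \<in> ?D" "q \<in> ?D" "r = exponent (map2 (*) p q)" for p q
    proof -
      have "map (Poly_Mapping.lookup r) [0..<h] = map2 (*) p q"
        using that map_lookup_exponent[of "map2 (*) p q"] by (simp add: decreasing_lists_def)
      then show ?thesis
        using that by (simp add: factor_pairs_iff[where h = h] map2_times_decreasing)
    qed
    then show "{x \<in> ?D \<times> ?D. mfps_nth (?F x) r \<noteq> 0}
        \<subseteq> factor_pairs (map (Poly_Mapping.lookup r) [0..<h])"
      by (auto simp: mfps_nth_monom split: if_splits)
  qed (rule finite_factor_pairs)
  then have total: "mfps_has_sum ?F (?D \<times> ?D) (mfps_infsum ?F (?D \<times> ?D))"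
    by (simp add: mfps_has_sum_def mfps_summable_on_def)
  have "mfps_has_sum (\<lambda>(m, x). ?F x) (Sigma ?D factor_pairs) (mfps_infsum ?F (?D \<times> ?D))"
    using mfps_has_sum_reindex[OF bij total] by (simp add: case_prod_unfold)
  moreover have "mfps_has_sum ?F (factor_pairs m)
      (mfps_monom (\<Sum>(p, q)\<in>factor_pairs m. w p * w q) (exponent m))" for m
  proof -
    have "(\<Sum>x\<in>factor_pairs m. ?F x)
        = (\<Sum>x\<in>factor_pairs m. mfps_monom (w (fst x) * w (snd x)) (exponent m))"
      by (rule sum.cong) (auto simp: factor_pairs_def)
    then show ?thesis
      using mfps_has_sum_finite[OF finite_factor_pairs, of ?F m]
      by (simp add: mfps_monom_sum case_prod_unfold)
  qed
  ultimately have "mfps_has_sum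
      (\<lambda>m. mfps_monom (\<Sum>(p, q)\<in>factor_pairs m. w p * w q) (exponent m)) ?D
      (mfps_infsum ?F (?D \<times> ?D))"
    by (rule mfps_has_sum_Sigma)
  then have "mfps_infsum ?F (?D \<times> ?D) = S"
    using mfps_has_sum_decreasing_lists unfolding S_def by (rule mfps_has_sum_unique)
  with total show ?thesis by simp
qed

text \<open>
  Summing over the second factor of a pair: in terms of the gaps \<open>k\<^sub>j\<close> of \<open>q\<close>, the monomial of
  \<open>map2 (*) n q\<close> is that of \<open>n\<close> times the product of the \<open>k\<^sub>j\<close>-th powers of the monomials of
  \<open>take (Suc j) n\<close>, so that the sum is a product of one-variable series.
\<close>

lemma mfps_has_sum_row:
  fixes w :: "nat list \<Rightarrow> int"
  assumes n: "n \<in> decreasing_lists h"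
    and w: "\<And>ks. length ks = h \<Longrightarrow> w (parts_of_gaps ks) = (\<Prod>j<h. g j (ks ! j))"
    and S: "\<And>j. j < h \<Longrightarrow>
      mfps_has_sum (\<lambda>k. mfps_monom (g j k) (multiple k (exponent (take (Suc j) n)))) UNIV (S j)"
  shows "mfps_has_sum (\<lambda>q. mfps_monom (w n * w q) (exponent (map2 (*) n q)))
    (decreasing_lists h) (mfps_monom (w n) (exponent n) * (\<Prod>j<h. S j))"
proof -
  have len: "length n = h" using n by (simp add: decreasing_lists_def)
  let ?F = "\<lambda>q. mfps_monom (w n * w q) (exponent (map2 (*) n q))"
  let ?L = "{ks :: nat list. length ks = h}"
  let ?G = "\<lambda>ks. mfps_monom (w n) (exponent n) *
      (\<Prod>j<h. mfps_monom (g j (ks ! j)) (multiple (ks ! j) (exponent (take (Suc j) n))))"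
  have G: "mfps_has_sum ?G ?L (mfps_monom (w n) (exponent n) * (\<Prod>j<h. S j))"
    by (intro mfps_has_sum_cmult mfps_has_sum_prod S)
  have eq: "?G ks = ?F (parts_of_gaps ks)" if "ks \<in> ?L" for ks
    using that len by (simp add: w mfps_monom_prod mfps_monom_times exponent_map2_parts_of_gaps)
  \<comment> \<open>\<open>?i q\<close> is the list of gaps of \<open>q\<close>; it turns the sum
    over gap lists into one over decreasing lists.\<close>
  let ?i = "inv_into ?L parts_of_gaps"
  have bij: "bij_betw ?i (decreasing_lists h) ?L"
    by (rule bij_betw_inv_into[OF bij_betw_parts_of_gaps])
  have inv: "parts_of_gaps (?i q) = q" if "q \<in> decreasing_lists h" for q
    using that by (rule bij_betw_inv_into_right[OF bij_betw_parts_of_gaps])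
  have "mfps_has_sum (\<lambda>q. ?G (?i q)) (decreasing_lists h)
      (mfps_monom (w n) (exponent n) * (\<Prod>j<h. S j))"
    by (rule mfps_has_sum_reindex[OF bij G])
  moreover have "?G (?i q) = ?F q" if "q \<in> decreasing_lists h" for q
    using eq[of "?i q"] inv[OF that] bij_betwE[OF bij] that by metis
  ultimately show ?thesis
    by (subst (asm) mfps_has_sum_cong) auto
qed

text \<open>The double sum of \<open>mfps_has_sum_pairs\<close> is evaluated by rows, with the first
  factor \<open>n\<close> fixed. The weight of the second factor splits over its gaps, so a row is a
  product of series, each inverse to one denominator \<open>d n j\<close>.\<close>

lemma mfps_has_sum_quotients:
  fixes w :: "nat list \<Rightarrow> int"
  assumes w: "\<And>ks. length ks = h \<Longrightarrow> w (parts_of_gaps ks) = (\<Prod>j<h. g j (ks ! j))"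
    and inverse: "\<And>j n. j < h \<Longrightarrow> n \<in> decreasing_lists h \<Longrightarrow> \<exists>S. d n j * S = 1 \<and>
      mfps_has_sum (\<lambda>k. mfps_monom (g j k) (multiple k (exponent (take (Suc j) n)))) UNIV S"
  shows "mfps_has_sum
    (\<lambda>n. (of_int (w n) * (\<Prod>i<h. mfps_X i ^ (n ! i))) / (\<Prod>j<h. d n j)) (decreasing_lists h)
    (mfps_infsum (\<lambda>m. of_int (\<Sum>(p, q)\<in>factor_pairs m. w p * w q) *
      (\<Prod>i<h. mfps_X i ^ (m ! i))) (decreasing_lists h))"
proof (rule mfps_has_sum_Sigma[OF mfps_has_sum_pairs])
  fix n assume n: "n \<in> decreasing_lists h"
  obtain S where S: "\<And>j. j < h \<Longrightarrow> d n j * S j = 1"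
    "\<And>j. j < h \<Longrightarrow>
      mfps_has_sum (\<lambda>k. mfps_monom (g j k) (multiple k (exponent (take (Suc j) n)))) UNIV (S j)"
    using inverse[OF _ n] by metis
  have "(\<Prod>j<h. d n j) * (\<Prod>j<h. S j) = 1"
    by (simp add: prod.distrib[symmetric] S(1))
  then have "inverse (\<Prod>j<h. d n j) = (\<Prod>j<h. S j)"
    by (rule mfps_inverse_unique)
  moreover have "of_int (w n) * (\<Prod>i<h. mfps_X i ^ (n ! i)) = mfps_monom (w n) (exponent n)"
    using n by (simp add: prod_mfps_X of_int_mfps mfps_monom_times decreasing_lists_def)
  ultimately show "mfps_has_sum (\<lambda>q. mfps_monom (w n * w q) (exponent (map2 (*) n q)))
      (decreasing_lists h)
      ((of_int (w n) * (\<Prod>i<h. mfps_X i ^ (n ! i))) / (\<Prod>j<h. d n j))"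
    using mfps_has_sum_row[OF n w S(2)] by (simp add: divide_mfps_def)
qed

text \<open>The first entry is positive and belongs to every prefix, so the geometric series in the
  prefix monomials exist.\<close>

lemma exponent_take_nonzero:
  assumes "n \<in> decreasing_lists h" "j < h"
  shows "exponent (take (Suc j) n) \<noteq> 0"
proof -
  have "Poly_Mapping.lookup (exponent (take (Suc j) n)) 0 = n ! 0" "1 \<le> n ! 0"
    using assms by (auto simp: lookup_exponent decreasing_lists_iff_nth)
  then show ?thesis by force
qed

lemma espalier_gf_has_sum:
  "mfps_has_sum
    (\<lambda>n. (\<Prod>i<h. mfps_X i ^ (n ! i)) / (\<Prod>j=1..h. 1 - (\<Prod>i<j. mfps_X i ^ (n ! i))))
    (decreasing_lists h) (espalier_gf h)"
proof -
  \<comment> \<open>Here \<open>j\<close> starts at \<open>0\<close>, so \<open>?d n j\<close> is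
    the denominator built from the first \<open>Suc j\<close> variables.\<close>
  let ?d = "\<lambda>n j. 1 - (\<Prod>i<Suc j. mfps_X i ^ (n ! i)) :: int mfps"
  have "mfps_has_sum
      (\<lambda>n. (of_int 1 * (\<Prod>i<h. mfps_X i ^ (n ! i))) / (\<Prod>j<h. ?d n j)) (decreasing_lists h)
      (mfps_infsum (\<lambda>m. of_int (\<Sum>(p, q)\<in>factor_pairs m. 1 * 1) *
        (\<Prod>i<h. mfps_X i ^ (m ! i))) (decreasing_lists h))"
  proof (rule mfps_has_sum_quotients[where w = "\<lambda>_. 1" and g = "\<lambda>_ _. 1"])
    fix j n assume jn: "j < h" "n \<in> decreasing_lists h"
    then have "?d n j = 1 - mfps_monom 1 (exponent (take (Suc j) n))"
      by (subst prod_mfps_X) (auto simp: decreasing_lists_def)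
    then show "\<exists>S. ?d n j * S = 1 \<and>
        mfps_has_sum (\<lambda>k. mfps_monom 1 (multiple k (exponent (take (Suc j) n)))) UNIV S"
      using mfps_geometric[OF exponent_take_nonzero[OF jn(2,1)]] by metis
  qed simp
  then show ?thesis
    by (simp add: prod.atLeast1_atMost_eq espalier_gf_def espalier_count_eq case_prod_unfold
        del: prod.lessThan_Suc)
qed

lemma pyramid_gf_has_sum:
  assumes "1 \<le> h"
  shows "mfps_has_sum
    (\<lambda>n. (of_int (gap_product n) * (\<Prod>i<h. mfps_X i ^ (n ! i))) /
      ((\<Prod>j=1..h-1. (1 - (\<Prod>i<j. mfps_X i ^ (n ! i)))\<^sup>2) *
        (1 - (\<Prod>i<h. mfps_X i ^ (n ! i)))))
    (decreasing_lists h) (pyramid_gf h)"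
proof -
  let ?y = "\<lambda>n j. (\<Prod>i<j. mfps_X i ^ (n ! i)) :: int mfps"
  let ?d = "\<lambda>n j. if Suc j < h then (1 - ?y n (Suc j))\<^sup>2 else 1 - ?y n (Suc j)"
  \<comment> \<open>The last gap, \<open>Suc j = h\<close>, has weight \<open>1\<close>; this is why
    the last denominator is not squared.\<close>
  let ?g = "\<lambda>j k. if Suc j < h then int (Suc k) else 1"
  obtain h' where h: "h = Suc h'"
    using assms by (cases h) auto
  have "mfps_has_sum
      (\<lambda>n. (of_int (gap_product n) * ?y n h) / (\<Prod>j<h. ?d n j)) (decreasing_lists h)
      (mfps_infsum (\<lambda>m. of_int (\<Sum>(p, q)\<in>factor_pairs m. gap_product p * gap_product q) * ?y m h)
        (decreasing_lists h))"
  proof (rule mfps_has_sum_quotients[where g = ?g])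
    fix ks :: "nat list" assume "length ks = h"
    then show "gap_product (parts_of_gaps ks) = (\<Prod>j<h. ?g j (ks ! j))"
      by (simp add: gap_product_parts_of_gaps h)
  next
    fix j n assume jn: "j < h" "n \<in> decreasing_lists h"
    then have y: "?y n (Suc j) = mfps_monom 1 (exponent (take (Suc j) n))"
      by (subst prod_mfps_X) (auto simp: decreasing_lists_def)
    note e = exponent_take_nonzero[OF jn(2,1)]
    show "\<exists>S. ?d n j * S = 1 \<and>
        mfps_has_sum (\<lambda>k. mfps_monom (?g j k) (multiple k (exponent (take (Suc j) n)))) UNIV S"
    proof (cases "Suc j < h")
      case True
      obtain S where "mfps_has_sum (\<lambda>k. mfps_monom (int (Suc k))
            (multiple k (exponent (take (Suc j) n)))) UNIV S"
          "(1 - mfps_monom 1 (exponent (take (Suc j) n)))\<^sup>2 * S = 1"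
        using mfps_geometric_square[OF e, where ?'a = int] by blast
      then show ?thesis
        unfolding y using True by (intro exI[of _ S]) simp
    next
      case False
      obtain S :: "int mfps" where "mfps_has_sum (\<lambda>k. mfps_monom 1
            (multiple k (exponent (take (Suc j) n)))) UNIV S"
          "(1 - mfps_monom 1 (exponent (take (Suc j) n))) * S = 1"
        using mfps_geometric[OF e] by blast
      then show ?thesis
        unfolding y using False by (intro exI[of _ S]) simp
    qed
  qed
  moreover have "(\<Prod>j<h. ?d n j) = (\<Prod>j=1..h-1. (1 - ?y n j)\<^sup>2) * (1 - ?y n h)" for n
    by (simp add: h prod.atLeast1_atMost_eq)
  moreover have "pyramid_gf h = mfps_infsum
      (\<lambda>m. of_int (\<Sum>(p, q)\<in>factor_pairs m. gap_product p * gap_product q) * ?y m h)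
      (decreasing_lists h)"
    unfolding pyramid_gf_def
  proof (rule mfps_infsum_cong)
    fix m assume "m \<in> decreasing_lists h"
    then have "m \<noteq> []"
      using h by (auto simp: decreasing_lists_def)
    from pyramid_count_eq[OF this, symmetric]
    show "of_nat (pyramid_count m) * ?y m h
        = of_int (\<Sum>(p, q)\<in>factor_pairs m. gap_product p * gap_product q) * ?y m h"
      by simp
  qed
  ultimately show ?thesis by simp
qed

theorem theorem1:
  fixes h :: nat
  assumes "1 \<le> h"
  shows "espalier_dirichlet h = (multizeta h)\<^sup>2 \<and>
    pyramid_dirichlet h = (multizeta_gap h)\<^sup>2 \<and>
    mfps_has_sum
      (\<lambda>n. (\<Prod>i<h. mfps_X i ^ (n ! i)) /
        (\<Prod>j=1..h. 1 - (\<Prod>i<j. mfps_X i ^ (n ! i))))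
      (decreasing_lists h) (espalier_gf h) \<and>
    mfps_has_sum
      (\<lambda>n. (of_int (gap_product n) * (\<Prod>i<h. mfps_X i ^ (n ! i))) /
        ((\<Prod>j=1..h-1. (1 - (\<Prod>i<j. mfps_X i ^ (n ! i)))\<^sup>2) *
          (1 - (\<Prod>i<h. mfps_X i ^ (n ! i)))))
      (decreasing_lists h) (pyramid_gf h)"
proof (intro conjI)
  \<comment> \<open>With weight \<open>1\<close> the sum over factor pairs is their number, which is
    the espalier count.\<close>
  show "espalier_dirichlet h = (multizeta h)\<^sup>2"
    using dirichlet_sum_square[of "\<lambda>_. 1" h]
    by (simp add: dirichlet_sum_def espalier_dirichlet_def multizeta_def espalier_count_eq
        case_prod_unfold)
  have "pyramid_dirichlet h
      = dirichlet_sum (\<lambda>m. \<Sum>(p, q)\<in>factor_pairs m. gap_product p * gap_product q) h"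
    unfolding pyramid_dirichlet_def dirichlet_sum_def
  proof (rule mds_infsum_cong)
    fix m assume "m \<in> decreasing_lists h"
    then have "m \<noteq> []"
      using assms by (auto simp: decreasing_lists_def)
    from pyramid_count_eq[OF this, symmetric]
    show "of_nat (pyramid_count m) * (\<Prod>i<h. mds_pow i (m ! i))
        = of_int (\<Sum>(p, q)\<in>factor_pairs m. gap_product p * gap_product q) *
          (\<Prod>i<h. mds_pow i (m ! i))"
      by simp
  qed
  then show "pyramid_dirichlet h = (multizeta_gap h)\<^sup>2"
    by (simp add: dirichlet_sum_square, simp add: dirichlet_sum_def multizeta_gap_def)
qed (rule espalier_gf_has_sum pyramid_gf_has_sum[OF assms])+

end
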